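(* Let $C\in\mathcal{C}_d$ be a closed convex cone, and let $g$ be a standard Gaussian vector in $\mathbb{R}^d$. For each parameter $\eta\in\mathbb{R}$, $$\mathbb{E}\, e^{\eta V_C}=\mathbb{E}\, e^{\xi\,\|\Pi_C(g)\|^2}\quad\text{where}\quad \xi=\tfrac12\big(1-e^{-2\eta}\big).$$
   Context: $\mathbb{R}^d$ carries the standard inner product $\langle\cdot,\cdot\rangle$ and Euclidean norm $\|\cdot\|$. Cones. A convex cone $C\subset\mathbb{R}^d$ is a nonempty set with $\tau(x+y)\in C$ for all $\tau>0$, $x,y\in C$; $\mathcal{C}_d$ is the set of closed convex cones in $\mathbb{R}^d$. The polar cone is $C^\circ=\{u\in\mathbb{R}^d:\langle u,x\rangle\le 0 \text{ for all } x\in C\}\in\mathcal{C}_d$. The metric projector onto $C$ is $\Pi_C(x)=\arg\min\{\|x-y\|^2:y\in C\}$. A cone is polyhedral if it is a finite intersection of halfspaces $\{x:\langle u_i,x\rangle\ge0\}$. A face of a polyhedral cone $C$ is a set of the form $\{x\in C:\langle u,x\rangle=\sup_{y\in C}\langle u,y\rangle\}$ with $u\in C^\circ$; its dimension is the dimension of its linear hull, and its relative interior is its interior relative to its linear hull. Conic Hausdorff metric. For nonzero $x,y$ put $\mathrm{dist}_s(x,y)=\arccos\big(\langle x,y\rangle/(\|x\|\|y\|)\big)$, with $\mathrm{dist}_s(0,0)=0$ and $\mathrm{dist}_s(x,0)=\mathrm{dist}_s(0,x)=\pi/2$ for $x\ne0$. Put $\mathcal{T}_s(C,\alpha)=\{x\in\mathbb{R}^d:\mathrm{dist}_s(x,y)\le\alpha\text{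 for some }y\in C\}$. The conic Hausdorff metric on $\mathcal{C}_d$ is $\mathrm{dist}_{\mathcal H}(C_1,C_2)=\inf\{\alpha\ge0:\mathcal{T}_s(C_1,\alpha)\supset C_2\text{ and }\mathcal{T}_s(C_2,\alpha)\supset C_1\}$. Conic intrinsic volumes. For polyhedral $C\in\mathcal{C}_d$ and $k=0,\dots,d$, $v_k(C)=\mathbb{P}\{\Pi_C(g)\text{ lies in the relative interior of a }k\text{-dimensional face of }C\}$, with $g$ a standard Gaussian vector in $\mathbb{R}^d$. For general $C\in\mathcal{C}_d$, $v_k(C)=\lim_{i\to\infty}v_k(C_i)$ for any sequence of polyhedral cones $C_i\in\mathcal{C}_d$ with $C_i\to C$ in the conic Hausdorff metric (polyhedral cones are dense, and the limit exists and does not depend on the sequence). The numbers $v_0(C),\dots,v_d(C)$ are nonnegative and sum to one. The intrinsic volume random variable $V_C$ has distribution $\mathbb{P}\{V_C=k\}=v_k(C)$ for $k=0,1,\dots,d$. *)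

theory Defs
  imports "HOL-Probability.Probability"
begin

definition closed_convex_cone :: "'a::euclidean_space set \<Rightarrow> bool" where
  "closed_convex_cone C \<longleftrightarrow> closed C \<and> convex_cone C"

text \<open>The library's convex cones contain 0. For closed sets they agree with the nonempty sets
  that contain \<open>\<tau> (x + y)\<close> whenever \<open>\<tau> > 0\<close> and \<open>x\<close>, \<open>y\<close> are in the set.\<close>

lemma closed_convex_cone_iff:
  "closed_convex_cone C \<longleftrightarrow>
    closed C \<and> C \<noteq> {} \<and> (\<forall>\<tau>>0. \<forall>x\<in>C. \<forall>y\<in>C. \<tau> *\<^sub>R (x + y) \<in> C)"
proof
  assume "closed_convex_cone C"
  then show "closed C \<and> C \<noteq> {} \<and> (\<forall>\<tau>>0. \<forall>x\<in>C. \<forall>y\<in>C. \<tau> *\<^sub>R (x + y) \<in> C)"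
    by (auto simp: closed_convex_cone_def convex_cone_iff)
next
  assume R: "closed C \<and> C \<noteq> {} \<and> (\<forall>\<tau>>0. \<forall>x\<in>C. \<forall>y\<in>C. \<tau> *\<^sub>R (x + y) \<in> C)"
  have add: "x + y \<in> C" if "x \<in> C" "y \<in> C" for x y
    using R that by (metis scaleR_one zero_less_one)
  have pos: "c *\<^sub>R x \<in> C" if "x \<in> C" "c > 0" for x c
  proof -
    have "(c / 2) *\<^sub>R (x + x) \<in> C"
      using R that by (simp del: scaleR_add_right)
    moreover have "(c / 2) *\<^sub>R (x + x) = c *\<^sub>R x"
      by (metis field_sum_of_halves scaleR_add_left scaleR_add_right)
    ultimately show ?thesis by simp
  qed
  obtain x where x: "x \<in> C" using R by blast
  have "(\<lambda>n. (1 / real (Suc n)) *\<^sub>R x) \<longlonglongrightarrow> 0 *\<^sub>R x"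
    using LIMSEQ_inverse_real_of_nat by (intro tendsto_scaleR) (auto simp: inverse_eq_divide)
  then have 0: "0 \<in> C"
    using R pos[OF x] closed_sequentially[of C "\<lambda>n. (1 / real (Suc n)) *\<^sub>R x" 0] by simp
  then show "closed_convex_cone C"
    using R add pos by (auto simp: closed_convex_cone_def convex_cone_iff order_le_less)
qed

definition polar_cone :: "'a::euclidean_space set \<Rightarrow> 'a set" where
  "polar_cone C = {u. \<forall>x\<in>C. u \<bullet> x \<le> 0}"

definition polyhedral_cone :: "'a::euclidean_space set \<Rightarrow> bool" where
  "polyhedral_cone C \<longleftrightarrow> (\<exists>U. finite U \<and> C = (\<Inter>u\<in>U. {x. u \<bullet> x \<ge> 0}))"

definition is_face_of_cone :: "'a::euclidean_space set \<Rightarrow> 'a set \<Rightarrow> bool" where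
  "is_face_of_cone F C \<longleftrightarrow> (\<exists>u\<in>polar_cone C. F = {x\<in>C. u \<bullet> x = (SUP y\<in>C. u \<bullet> y)})"

text \<open>\<^const>\<open>rel_interior\<close> is taken relative to the affine hull, which for a face of a
  polyhedral cone is its linear hull.\<close>

lemma rel_interior_face_of_cone:
  assumes "polyhedral_cone C" and "is_face_of_cone F C"
  shows "rel_interior F = top_of_set (span F) interior_of F"
proof -
  obtain u where u: "u \<in> polar_cone C" and F: "F = {x\<in>C. u \<bullet> x = (SUP y\<in>C. u \<bullet> y)}"
    using assms(2) by (auto simp: is_face_of_cone_def)
  have C: "0 \<in> C"
    using assms(1) by (auto simp: polyhedral_cone_def)
  have "(SUP y\<in>C. u \<bullet> y) = 0"
    using u C by (intro cSup_eq_maximum) (auto simp: polar_cone_def image_iff intro!: bexI[of _ 0])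
  with C F have "0 \<in> F" by simp
  then have "affine hull F = span F"
    by (intro affine_hull_span_0 hull_inc)
  then show ?thesis
    by (auto simp: rel_interior_def interior_of_def)
qed

definition conic_dist :: "'a::euclidean_space \<Rightarrow> 'a \<Rightarrow> real" where
  "conic_dist x y =
    (if x = 0 \<and> y = 0 then 0
     else if x = 0 \<or> y = 0 then pi / 2
     else arccos ((x \<bullet> y) / (norm x * norm y)))"

definition conic_expansion :: "'a::euclidean_space set \<Rightarrow> real \<Rightarrow> 'a set" where
  "conic_expansion C \<alpha> = {x. \<exists>y\<in>C. conic_dist x y \<le> \<alpha>}"

definition conic_hausdorff_dist :: "'a::euclidean_space set \<Rightarrow> 'a set \<Rightarrow> real" where
  "conic_hausdorff_dist C1 C2 =
    Inf {\<alpha>. \<alpha> \<ge> 0 \<and> C2 \<subseteq> conic_expansion C1 \<alpha> \<and> C1 \<subseteq> conic_expansion C2 \<alpha>}"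

text \<open>The standard Gaussian distribution: the coordinates in the orthonormal basis
  \<^const>\<open>Basis\<close> are independent standard normal variables.\<close>

definition std_gaussian_density :: "'a::euclidean_space \<Rightarrow> real" where
  "std_gaussian_density x = (\<Prod>b\<in>Basis. std_normal_density (x \<bullet> b))"

definition std_gaussian :: "'a::euclidean_space measure" where
  "std_gaussian = density lborel (\<lambda>x. ennreal (std_gaussian_density x))"

text \<open>The metric projector onto \<open>C\<close> is the library's \<^term>\<open>closest_point C\<close>.\<close>

definition polyhedral_intrinsic_volume :: "'a::euclidean_space set \<Rightarrow> nat \<Rightarrow> real" where
  "polyhedral_intrinsic_volume C k =
    measure std_gaussian
      {x. \<exists>F. is_face_of_cone F C \<and> dim F = k \<and> closest_point C x \<in> rel_interior F}"

definition conic_intrinsic_volume :: "'a::euclidean_space set \<Rightarrow> nat \<Rightarrow> real" where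
  "conic_intrinsic_volume C k =
    (if polyhedral_cone C then polyhedral_intrinsic_volume C k
     else THE v. \<forall>Cs :: nat \<Rightarrow> 'a set.
       (\<forall>i. polyhedral_cone (Cs i)) \<and> (\<lambda>i. conic_hausdorff_dist (Cs i) C) \<longlonglongrightarrow> 0 \<longrightarrow>
       (\<lambda>i. polyhedral_intrinsic_volume (Cs i) k) \<longlonglongrightarrow> v)"

end

theory Submission
  imports Defs
begin

text \<open>For a polyhedral cone, split the Gaussian space according to the face \<open>F\<close> whose relative
  interior contains the projection. On the corresponding piece, the weight
  \<open>exp (\<xi> * (norm (closest_point C x))\<^sup>2)\<close> turns the Gaussian density at \<open>x\<close> into the density at the
  point obtained by dilating the \<open>span F\<close> component of \<open>x\<close> by \<open>sqrt (1 - 2 * \<xi>) = exp (- \<eta>)\<close>.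
  The piece is invariant under this dilation, whose determinant is \<open>exp (- \<eta> * dim F)\<close>, so it
  contributes \<open>exp (\<eta> * dim F)\<close> times its Gaussian measure. For a general cone the right-hand side
  is a limit over polyhedral approximations by dominated convergence. Moment generating functions
  of the intrinsic volumes are polynomials of bounded degree in \<open>exp \<eta>\<close>, so their pointwise
  convergence is equivalent to that of the intrinsic volumes.\<close>

section \<open>Lebesgue measure under orthogonal maps and dilations of subspaces\<close>

lemma nn_integral_lborel_translate:
  fixes f :: "'a::euclidean_space \<Rightarrow> ennreal"
  assumes [measurable]: "f \<in> borel_measurable borel"
  shows "(\<integral>\<^sup>+x. f (c + x) \<partial>lborel) = (\<integral>\<^sup>+x. f x \<partial>lborel)"
proof -
  have "(\<integral>\<^sup>+x. f x \<partial>lborel) = (\<integral>\<^sup>+x. f x \<partial>distr lborel borel ((+) c))"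
    by (simp add: lborel_distr_plus)
  also have "\<dots> = (\<integral>\<^sup>+x. f (c + x) \<partial>lborel)"
    by (subst nn_integral_distr) auto
  finally show ?thesis by simp
qed

lemma nn_integral_lborel_uminus:
  fixes f :: "'a::euclidean_space \<Rightarrow> ennreal"
  assumes [measurable]: "f \<in> borel_measurable borel"
  shows "(\<integral>\<^sup>+x. f (- x) \<partial>lborel) = (\<integral>\<^sup>+x. f x \<partial>lborel)"
proof -
  have "(\<integral>\<^sup>+x. f x \<partial>lborel) =
      (\<integral>\<^sup>+x. f x \<partial>density (distr lborel borel (\<lambda>x. 0 + (- 1) *\<^sub>R x)) (\<lambda>_. ennreal (\<bar>- 1\<bar> ^ DIM('a))))"
    by (subst lborel_affine[of "- 1" 0]) simp_all
  also have "\<dots> = (\<integral>\<^sup>+x. f (- x) \<partial>lborel)"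
    by (subst nn_integral_density) (auto simp: nn_integral_distr)
  finally show ?thesis by simp
qed

text \<open>Uniqueness of Haar measure, by Fubini: comparing the image of \<^const>\<open>lborel\<close> under
  \<open>R\<close> with \<^const>\<open>lborel\<close> on the unit ball, which \<open>R\<close> preserves, shows that they agree.\<close>

lemma nn_integral_lborel_orthogonal_transformation:
  fixes f :: "'a::euclidean_space \<Rightarrow> ennreal" and R :: "'a \<Rightarrow> 'a"
  assumes R: "orthogonal_transformation R" and [measurable]: "f \<in> borel_measurable borel"
  shows "(\<integral>\<^sup>+x. f (R x) \<partial>lborel) = (\<integral>\<^sup>+x. f x \<partial>lborel)"
proof -
  have lin: "linear R" and surj: "surj R"
    using R by (simp_all add: orthogonal_transformation_linear orthogonal_transformation_surj)
  have [measurable]: "R \<in> borel_measurable borel"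
    using lin by (intro borel_measurable_continuous_onI linear_continuous_on)
      (simp add: linear_conv_bounded_linear)
  define h :: "'a \<Rightarrow> ennreal" where "h = indicator (ball 0 1)"
  have [measurable]: "h \<in> borel_measurable borel"
    unfolding h_def by (intro borel_measurable_indicator) simp
  have hR: "h (R x) = h x" for x
    using orthogonal_transformation_norm[OF R] by (simp add: h_def indicator_def)
  have I: "(\<integral>\<^sup>+x. h x \<partial>lborel) = emeasure lborel (ball (0::'a) 1)"
    by (simp add: h_def)
  have "(\<integral>\<^sup>+x. f (R x) \<partial>lborel) * (\<integral>\<^sup>+y. h y \<partial>lborel) =
      (\<integral>\<^sup>+x. \<integral>\<^sup>+y. f (R x) * h y \<partial>lborel \<partial>lborel)"
    by (simp add: nn_integral_cmult nn_integral_multc)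
  \<comment> \<open>For fixed \<open>x\<close>, translating \<open>y\<close> by \<open>R x\<close>
    leaves the integral of \<open>h\<close> unchanged and couples the two variables.\<close>
  also have "\<dots> = (\<integral>\<^sup>+x. \<integral>\<^sup>+y. f (R x) * h (R x + y) \<partial>lborel \<partial>lborel)"
    by (subst nn_integral_lborel_translate[where f = "\<lambda>y. f _ * h y"]) simp_all
  also have "\<dots> = (\<integral>\<^sup>+y. \<integral>\<^sup>+x. f (R x) * h (R x + y) \<partial>lborel \<partial>lborel)"
    by (intro lborel_pair.Fubini') simp
  also have "\<dots> = (\<integral>\<^sup>+y. \<integral>\<^sup>+x. f (R x - y) * h x \<partial>lborel \<partial>lborel)"
  proof (rule nn_integral_cong)
    fix y :: 'a
    \<comment> \<open>Shifting \<open>x\<close> by \<open>- w\<close> turns \<open>R x + y\<close>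
      into \<open>R x\<close>, and \<open>h (R x) = h x\<close> because \<open>R\<close> preserves
      the ball.\<close>
    obtain w where w: "y = R w"
      using surj by blast
    have "(\<integral>\<^sup>+x. f (R x) * h (R x + y) \<partial>lborel) =
        (\<integral>\<^sup>+x. f (R (- w + x)) * h (R (- w + x) + y) \<partial>lborel)"
      by (subst nn_integral_lborel_translate[where f = "\<lambda>x. f (R x) * h (R x + y)"]) simp_all
    also have "\<dots> = (\<integral>\<^sup>+x. f (R x - y) * h x \<partial>lborel)"
      by (simp add: linear_diff[OF lin] w hR)
    finally show "(\<integral>\<^sup>+x. f (R x) * h (R x + y) \<partial>lborel) = (\<integral>\<^sup>+x. f (R x - y) * h x \<partial>lborel)" .
  qed
  also have "\<dots> = (\<integral>\<^sup>+x. \<integral>\<^sup>+y. f (R x - y) * h x \<partial>lborel \<partial>lborel)"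
    by (intro lborel_pair.Fubini') simp
  also have "\<dots> = (\<integral>\<^sup>+x. (\<integral>\<^sup>+y. f y \<partial>lborel) * h x \<partial>lborel)"
  proof (rule nn_integral_cong)
    fix x :: 'a
    have "(\<integral>\<^sup>+y. f (R x - y) \<partial>lborel) = (\<integral>\<^sup>+y. f (R x + y) \<partial>lborel)"
      using nn_integral_lborel_uminus[of "\<lambda>y. f (R x + y)"] by simp
    also have "\<dots> = (\<integral>\<^sup>+y. f y \<partial>lborel)"
      by (rule nn_integral_lborel_translate) simp
    finally show "(\<integral>\<^sup>+y. f (R x - y) * h x \<partial>lborel) = (\<integral>\<^sup>+y. f y \<partial>lborel) * h x"
      by (simp add: nn_integral_multc)
  qed
  also have "\<dots> = (\<integral>\<^sup>+y. f y \<partial>lborel) * (\<integral>\<^sup>+y. h y \<partial>lborel)"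
    by (simp add: nn_integral_cmult)
  finally have *: "(\<integral>\<^sup>+x. f (R x) \<partial>lborel) * (\<integral>\<^sup>+y. h y \<partial>lborel) =
      (\<integral>\<^sup>+y. f y \<partial>lborel) * (\<integral>\<^sup>+y. h y \<partial>lborel)" .
  \<comment> \<open>Cancelling the factor requires a ball of positive, finite measure.\<close>
  have "emeasure lborel (ball (0::'a) 1) \<noteq> 0"
    using content_ball_pos[of 1 "0::'a"] by (auto simp: measure_def)
  with I have "(\<integral>\<^sup>+y. h y \<partial>lborel) \<noteq> 0" "(\<integral>\<^sup>+y. h y \<partial>lborel) \<noteq> \<top>"
    using emeasure_lborel_ball_finite[of "0::'a" 1] by auto
  with * show ?thesis
    by (simp add: ennreal_mult_cancel_left mult.commute[of _ "\<integral>\<^sup>+y. h y \<partial>lborel"])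
qed

text \<open>The witness is the reflection in the hyperplane orthogonal to \<open>a - b\<close>; it
  degenerates to the identity when \<open>a = b\<close>.\<close>

lemma orthogonal_transformation_reflection_exists:
  fixes a b :: "'a::euclidean_space"
  assumes "norm a = norm b"
  obtains R where "orthogonal_transformation R" "R a = b" "\<And>x. R (R x) = x"
proof
  define v where "v = a - b"
  define R where "R x = x - (2 * (x \<bullet> v) / (v \<bullet> v)) *\<^sub>R v" for x
  have Rv: "R x \<bullet> v = - (x \<bullet> v)" for x
    by (cases "v = 0") (simp_all add: R_def inner_diff_left)
  show "orthogonal_transformation R"
    unfolding orthogonal_transformation_def
  proof (intro conjI allI)
    show "linear R"
      by (intro linearI) (simp_all add: R_def inner_add_left algebra_simps add_divide_distrib)
    show "R x \<bullet> R y = x \<bullet> y" for x y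
    proof -
      have "R x \<bullet> R y = R x \<bullet> y - (2 * (y \<bullet> v) / (v \<bullet> v)) * (R x \<bullet> v)"
        by (simp add: R_def[of y] inner_diff_right)
      also have "R x \<bullet> y = x \<bullet> y - (2 * (x \<bullet> v) / (v \<bullet> v)) * (y \<bullet> v)"
        by (simp add: R_def inner_diff_left inner_commute[of v y])
      finally show ?thesis
        by (simp add: Rv)
    qed
  qed
  \<comment> \<open>Equal norms make the coefficient of \<open>v\<close> in \<open>R a\<close> equal
    to 1, unless \<open>v = 0\<close>.\<close>
  have "a \<bullet> a = b \<bullet> b"
    using assms by (simp add: dot_square_norm)
  then have "2 * (a \<bullet> v) = v \<bullet> v"
    by (simp add: v_def inner_diff inner_commute)
  then show "R a = b"
    by (cases "v = 0") (simp_all add: R_def, simp_all add: v_def)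
  show "R (R x) = x" for x
    using Rv[of x] by (subst R_def) (simp add: R_def)
qed

text \<open>A reflection exchanging \<open>b\<close> with a basis vector conjugates this map to the
  dilation of a single coordinate, whose determinant is \<open>s\<close>.\<close>

lemma nn_integral_lborel_scale_direction:
  fixes f :: "'a::euclidean_space \<Rightarrow> ennreal" and b :: 'a
  assumes b: "norm b = 1" and s: "s > 0" and [measurable]: "f \<in> borel_measurable borel"
  shows "ennreal s * (\<integral>\<^sup>+x. f (x + ((s - 1) * (x \<bullet> b)) *\<^sub>R b) \<partial>lborel) = (\<integral>\<^sup>+x. f x \<partial>lborel)"
proof -
  obtain e :: 'a where e: "e \<in> Basis"
    using nonempty_Basis by blast
  then obtain R where R: "orthogonal_transformation R" "R e = b" "\<And>x. R (R x) = x"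
    using orthogonal_transformation_reflection_exists[of e b] b by auto
  have lin: "linear R"
    using R by (simp add: orthogonal_transformation_linear)
  have [measurable]: "R \<in> borel_measurable borel"
    using lin by (intro borel_measurable_continuous_onI linear_continuous_on)
      (simp add: linear_conv_bounded_linear)
  have D: "0 + (\<Sum>j\<in>Basis. ((if j = e then s else 1) * (x \<bullet> j)) *\<^sub>R j) = x + ((s - 1) * (x \<bullet> e)) *\<^sub>R e"
    for x :: 'a
  proof -
    have "(\<Sum>j\<in>Basis. ((if j = e then s else 1) * (x \<bullet> j)) *\<^sub>R j) =
        (\<Sum>j\<in>Basis. (x \<bullet> j) *\<^sub>R j + (if j = e then ((s - 1) * (x \<bullet> e)) *\<^sub>R e else 0))"
      by (intro sum.cong) (auto simp: algebra_simps)
    then show ?thesis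
      using e by (simp add: sum.distrib euclidean_representation)
  qed
  have P: "(\<Prod>j\<in>Basis. \<bar>if j = e then s else 1\<bar>) = s"
  proof -
    have "(\<Prod>j\<in>Basis. \<bar>if j = e then s else 1\<bar>) = (\<Prod>j\<in>Basis. if j = e then s else 1)"
      using s by (intro prod.cong) auto
    then show ?thesis
      using e by simp
  qed
  have "(\<integral>\<^sup>+x. f x \<partial>lborel) = (\<integral>\<^sup>+x. f (R x) \<partial>lborel)"
    using R by (simp add: nn_integral_lborel_orthogonal_transformation)
  also have "\<dots> = (\<integral>\<^sup>+x. f (R x) \<partial>density (distr lborel borel
      (\<lambda>x. 0 + (\<Sum>j\<in>Basis. ((if j = e then s else 1) * (x \<bullet> j)) *\<^sub>R j)))
      (\<lambda>_. ennreal (\<Prod>j\<in>Basis. \<bar>if j = e then s else 1\<bar>)))"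
    using s by (subst lborel_affine_euclidean[of "\<lambda>j. if j = e then s else 1" 0]) auto
  also have "\<dots> = ennreal s * (\<integral>\<^sup>+x. f (R (x + ((s - 1) * (x \<bullet> e)) *\<^sub>R e)) \<partial>lborel)"
    unfolding D P by (simp add: nn_integral_density nn_integral_distr nn_integral_cmult)
  \<comment> \<open>Substituting \<open>R x\<close> for \<open>x\<close> completes the conjugation,
    since \<open>R\<close> is an involution with \<open>R e = b\<close>.\<close>
  also have "(\<integral>\<^sup>+x. f (R (x + ((s - 1) * (x \<bullet> e)) *\<^sub>R e)) \<partial>lborel) =
      (\<integral>\<^sup>+x. f (R (R x + ((s - 1) * (R x \<bullet> e)) *\<^sub>R e)) \<partial>lborel)"
    using R by (subst nn_integral_lborel_orthogonal_transformation[OF R(1),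
          of "\<lambda>x. f (R (x + ((s - 1) * (x \<bullet> e)) *\<^sub>R e))"]) simp_all
  also have "\<dots> = (\<integral>\<^sup>+x. f (x + ((s - 1) * (x \<bullet> b)) *\<^sub>R b) \<partial>lborel)"
  proof -
    have "R x \<bullet> e = x \<bullet> b" for x
      using R by (metis orthogonal_transformation_def)
    then show ?thesis
      by (simp add: linear_add[OF lin] linear_scale[OF lin] R)
  qed
  finally show ?thesis by simp
qed

text \<open>Induction on \<open>B\<close>, one direction at a time. The induction hypothesis is
  applied to \<open>f\<close> composed with the dilation along the new direction, so
  \<open>f\<close> has to be arbitrary.\<close>

lemma nn_integral_lborel_scale_orthonormal:
  fixes f :: "'a::euclidean_space \<Rightarrow> ennreal"
  assumes "finite B" "pairwise orthogonal B" "\<And>b. b \<in> B \<Longrightarrow> norm b = 1" "s > 0"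
    and "f \<in> borel_measurable borel"
  shows "ennreal (s ^ card B) * (\<integral>\<^sup>+x. f (x + (s - 1) *\<^sub>R (\<Sum>b\<in>B. (x \<bullet> b) *\<^sub>R b)) \<partial>lborel) =
    (\<integral>\<^sup>+x. f x \<partial>lborel)"
  using assms
proof (induction B arbitrary: f rule: finite_induct)
  case (insert a B)
  note [measurable] = insert.prems(4)
  define T where "T x = x + (s - 1) *\<^sub>R (\<Sum>b\<in>B. (x \<bullet> b) *\<^sub>R b)" for x :: 'a
  have [measurable]: "T \<in> borel_measurable borel"
    unfolding T_def by measurable
  have orth: "a \<bullet> b = 0" if "b \<in> B" for b
    using insert.prems(1) insert.hyps(2) that by (auto simp: pairwise_def orthogonal_def)
  \<comment> \<open>By orthogonality \<open>T\<close> keeps the component along \<open>a\<close>, so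
    the two dilations compose to the one along \<open>insert a B\<close>.\<close>
  then have "(\<Sum>b\<in>B. (x \<bullet> b) *\<^sub>R b) \<bullet> a = 0" for x
    by (subst inner_commute) (simp add: inner_sum_right)
  then have Txa: "T x \<bullet> a = x \<bullet> a" for x
    by (simp add: T_def inner_add_left)
  have Ta: "x + (s - 1) *\<^sub>R (\<Sum>b\<in>insert a B. (x \<bullet> b) *\<^sub>R b) =
      T x + ((s - 1) * (T x \<bullet> a)) *\<^sub>R a" for x
    unfolding Txa using insert.hyps by (simp add: T_def algebra_simps)
  have "ennreal (s ^ card B) * (\<integral>\<^sup>+x. f (T x + ((s - 1) * (T x \<bullet> a)) *\<^sub>R a) \<partial>lborel) =
      (\<integral>\<^sup>+x. f (x + ((s - 1) * (x \<bullet> a)) *\<^sub>R a) \<partial>lborel)"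
    unfolding T_def using insert.prems
    by (intro insert.IH[of "\<lambda>x. f (x + ((s - 1) * (x \<bullet> a)) *\<^sub>R a)"]) (auto simp: pairwise_insert)
  moreover have "ennreal s * (\<integral>\<^sup>+x. f (x + ((s - 1) * (x \<bullet> a)) *\<^sub>R a) \<partial>lborel) = (\<integral>\<^sup>+x. f x \<partial>lborel)"
    using insert.prems by (intro nn_integral_lborel_scale_direction) auto
  ultimately show ?case
    unfolding Ta using insert.hyps \<open>s > 0\<close>
    by (simp add: ennreal_mult mult.assoc)
qed simp

section \<open>Faces of polyhedral cones and metric projections\<close>

lemma polyhedral_cone_imp_polyhedron:
  assumes "polyhedral_cone C"
  shows "polyhedron C"
proof -
  obtain U where "finite U" "C = (\<Inter>u\<in>U. {x. u \<bullet> x \<ge> 0})"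
    using assms by (auto simp: polyhedral_cone_def)
  then show ?thesis
    by (auto intro!: polyhedron_Inter polyhedron_halfspace_ge)
qed

lemma polyhedral_cone_imp_closed_convex_cone:
  assumes "polyhedral_cone C"
  shows "closed_convex_cone C"
proof -
  obtain U where U: "C = (\<Inter>u\<in>U. {x. u \<bullet> x \<ge> 0})"
    using assms by (auto simp: polyhedral_cone_def)
  have "convex_cone C"
    unfolding U by (auto simp: convex_cone_iff inner_add_right)
  then show ?thesis
    using polyhedron_imp_closed[OF polyhedral_cone_imp_polyhedron[OF assms]]
    by (simp add: closed_convex_cone_def)
qed

text \<open>All faces of a polyhedron are exposed, and a hyperplane supporting a cone at one of its
  points passes through the origin. This makes finiteness of the set of faces and disjointness of
  their relative interiors available.\<close>

lemma is_face_of_cone_iff: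
  assumes "polyhedral_cone C"
  shows "is_face_of_cone F C \<longleftrightarrow> F \<noteq> {} \<and> F face_of C"
proof -
  have cone: "convex_cone C" and poly: "polyhedron C"
    using polyhedral_cone_imp_closed_convex_cone[OF assms] polyhedral_cone_imp_polyhedron[OF assms]
    by (simp_all add: closed_convex_cone_def)
  then have 0: "0 \<in> C" and conv: "convex C"
    by (simp_all add: convex_cone_contains_0 convex_cone_def)
  have Sup: "(SUP y\<in>C. u \<bullet> y) = 0" if "u \<in> polar_cone C" for u
    using that 0 by (intro cSup_eq_maximum) (auto simp: polar_cone_def image_iff intro!: bexI[of _ 0])
  have "is_face_of_cone F C \<longleftrightarrow> (\<exists>u\<in>polar_cone C. F = C \<inter> {x. u \<bullet> x = 0})"
    by (auto simp: is_face_of_cone_def Sup Int_def)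
  also have "\<dots> \<longleftrightarrow> F \<noteq> {} \<and> F exposed_face_of C"
  proof
    assume "\<exists>u\<in>polar_cone C. F = C \<inter> {x. u \<bullet> x = 0}"
    then show "F \<noteq> {} \<and> F exposed_face_of C"
      using 0 conv by (auto simp: polar_cone_def intro!: exposed_face_of_Int_supporting_hyperplane_le)
  next
    assume F: "F \<noteq> {} \<and> F exposed_face_of C"
    then obtain a b where ab: "C \<subseteq> {x. a \<bullet> x \<le> b}" "F = C \<inter> {x. a \<bullet> x = b}"
      by (auto simp: exposed_face_of_def)
    then obtain x where x: "x \<in> C" "a \<bullet> x = b"
      using F by auto
    \<comment> \<open>Doubling \<open>x\<close> gives \<open>2 * b \<le> b\<close>, while
      \<open>0 \<in> C\<close> gives \<open>0 \<le> b\<close>.\<close>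
    have "2 *\<^sub>R x \<in> C"
      using cone x by (simp add: convex_cone_scaleR)
    with ab x have "b \<le> 0" by auto
    with ab 0 have "b = 0" by auto
    with ab show "\<exists>u\<in>polar_cone C. F = C \<inter> {x. u \<bullet> x = 0}"
      by (intro bexI[of _ a]) (auto simp: polar_cone_def)
  qed
  finally show ?thesis
    using exposed_face_of_polyhedron[OF poly] by simp
qed

lemma is_face_of_cone_convex_cone:
  assumes "polyhedral_cone C" and "is_face_of_cone F C"
  shows "convex_cone F"
proof -
  have cone: "convex_cone C"
    using polyhedral_cone_imp_closed_convex_cone[OF assms(1)] by (simp add: closed_convex_cone_def)
  obtain u where u: "u \<in> polar_cone C" and F: "F = {x\<in>C. u \<bullet> x = (SUP y\<in>C. u \<bullet> y)}"
    using assms(2) by (auto simp: is_face_of_cone_def)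
  have "(SUP y\<in>C. u \<bullet> y) = 0"
    using u convex_cone_contains_0[OF cone]
    by (intro cSup_eq_maximum) (auto simp: polar_cone_def image_iff intro!: bexI[of _ 0])
  with cone F show ?thesis
    by (auto simp: convex_cone_iff inner_add_right)
qed

text \<open>A minimal face containing \<open>y\<close> works: were \<open>y\<close> on its relative
  boundary, a supporting hyperplane at \<open>y\<close> would cut out a smaller face that still
  contains \<open>y\<close>.\<close>

lemma face_with_point_in_rel_interior:
  fixes C :: "'a::euclidean_space set"
  assumes "polyhedron C" and "y \<in> C"
  obtains F where "F face_of C" "y \<in> rel_interior F"
proof -
  have conv: "convex C"
    using assms(1) by (rule polyhedron_imp_convex)
  have "finite {F. F face_of C \<and> y \<in> F}"
    by (rule finite_subset[OF _ finite_polyhedron_faces[OF assms(1)]]) auto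
  moreover have "C \<in> {F. F face_of C \<and> y \<in> F}"
    using conv assms(2) by (simp add: face_of_refl)
  ultimately obtain F where F: "F face_of C" "y \<in> F"
    and min: "\<And>G. \<lbrakk>G face_of C; y \<in> G; G \<subseteq> F\<rbrakk> \<Longrightarrow> G = F"
    using finite_has_minimal2[of "{F. F face_of C \<and> y \<in> F}" C] by auto
  have convF: "convex F"
    using F(1) by (rule face_of_imp_convex)
  have "y \<in> rel_interior F"
  proof (rule ccontr)
    assume "y \<notin> rel_interior F"
    from supporting_hyperplane_rel_boundary[OF convF F(2) this]
    obtain a where a: "a \<noteq> 0" "\<And>z. z \<in> F \<Longrightarrow> a \<bullet> y \<le> a \<bullet> z"
      "\<And>z. z \<in> rel_interior F \<Longrightarrow> a \<bullet> y < a \<bullet> z"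
      by metis
    have "F \<inter> {z. a \<bullet> z = a \<bullet> y} face_of F"
      using convF a(2) by (intro face_of_Int_supporting_hyperplane_ge) auto
    then have "F \<inter> {z. a \<bullet> z = a \<bullet> y} = F"
      using F by (intro min) (auto intro: face_of_trans)
    moreover obtain z where z: "z \<in> rel_interior F"
      using rel_interior_eq_empty[OF convF] F(2) by blast
    ultimately have "a \<bullet> z = a \<bullet> y"
      using rel_interior_subset[of F] by blast
    then show False
      using a(3)[OF z] by simp
  qed
  with F that show thesis by blast
qed

section \<open>Metric projection onto closed convex cones\<close>

text \<open>Moreau's conditions: the variational inequality of the projection onto a convex set,
  split in two by the scaling invariance of the cone.\<close>

lemma closest_point_cone:
  assumes "closed_convex_cone C"
  shows "closest_point C x \<in> C" "(x - closest_point C x) \<bullet> closest_point C x = 0"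
    "x - closest_point C x \<in> polar_cone C"
proof -
  have C: "closed C" "convex C" "convex_cone C" "C \<noteq> {}"
    using assms by (auto simp: closed_convex_cone_def convex_cone_def)
  define y where "y = closest_point C x"
  show y: "closest_point C x \<in> C"
    using C by (intro closest_point_in_set)
  have dot: "(x - y) \<bullet> (z - y) \<le> 0" if "z \<in> C" for z
    unfolding y_def using C that by (intro closest_point_dot)
  \<comment> \<open>Testing at \<open>0\<close> and at \<open>2 *\<^sub>R y\<close> bounds
    \<open>(x - y) \<bullet> y\<close> from both sides.\<close>
  have "(x - y) \<bullet> (0 - y) \<le> 0" "(x - y) \<bullet> (2 *\<^sub>R y - y) \<le> 0"
    using C y by (intro dot; simp add: convex_cone_contains_0 convex_cone_scaleR y_def)+
  then have 0: "(x - y) \<bullet> y = 0"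
    by (simp add: scaleR_2)
  then show "(x - closest_point C x) \<bullet> closest_point C x = 0"
    by (simp add: y_def)
  show "x - closest_point C x \<in> polar_cone C"
    using dot 0 by (simp add: polar_cone_def inner_diff_right y_def)
qed

text \<open>Conversely, Moreau's conditions give back the variational inequality, and expanding
  \<open>norm (x - z)\<close> around \<open>y\<close> shows that no \<open>z\<close> in
  \<open>C\<close> is nearer.\<close>

lemma closest_point_cone_eqI:
  assumes "closed_convex_cone C" and y: "y \<in> C" "(x - y) \<bullet> y = 0" "x - y \<in> polar_cone C"
  shows "closest_point C x = y"
proof -
  have C: "closed C" "convex C"
    using assms by (auto simp: closed_convex_cone_def convex_cone_def)
  have "dist x y \<le> dist x z" if "z \<in> C" for z
  proof -
    have "(x - y) \<bullet> (z - y) \<le> 0"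
      using y that by (simp add: polar_cone_def inner_diff_right)
    moreover have "(norm (x - z))\<^sup>2 = (norm (x - y))\<^sup>2 + (norm (z - y))\<^sup>2 - 2 * ((x - y) \<bullet> (z - y))"
      by (simp add: power2_norm_eq_inner inner_diff inner_commute)
    ultimately have "(norm (x - y))\<^sup>2 \<le> (norm (x - z))\<^sup>2"
      by (smt (verit) zero_le_power2)
    then show ?thesis
      by (simp add: dist_norm)
  qed
  then show ?thesis
    using closest_point_unique[of C y x] C y by auto
qed

text \<open>From a relative interior point of \<open>F\<close>, small steps along \<open>w\<close>
  and \<open>- w\<close> both stay in \<open>F\<close>, so the variational inequality holds with
  either sign.\<close>

lemma closest_point_rel_interior_orthogonal:
  fixes C :: "'a::euclidean_space set"
  assumes C: "closed_convex_cone C" and F: "F \<subseteq> C" "0 \<in> F"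
    and y: "closest_point C x \<in> rel_interior F" and w: "w \<in> span F"
  shows "(x - closest_point C x) \<bullet> w = 0"
proof -
  define y where "y = closest_point C x"
  have aff: "affine hull F = span F"
    using F by (intro affine_hull_span_0 hull_inc)
  obtain e where e: "e > 0" "ball y e \<inter> span F \<subseteq> F" "y \<in> F"
    using y by (auto simp: mem_rel_interior_ball y_def aff)
  \<comment> \<open>Small enough that \<open>t * norm w < e\<close>; the added 1 keeps the
    denominator positive when \<open>w = 0\<close>.\<close>
  define t where "t = e / (2 * (norm w + 1))"
  have t: "t > 0"
    using e by (simp add: t_def add_nonneg_pos)
  have "t * norm w < e"
    using e by (simp add: t_def divide_simps add_nonneg_pos)
  then have "y + t *\<^sub>R w \<in> ball y e" "y - t *\<^sub>R w \<in> ball y e"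
    using t by (simp_all add: dist_norm)
  moreover have "y + t *\<^sub>R w \<in> span F" "y - t *\<^sub>R w \<in> span F"
    using w e(3) by (auto intro: span_add span_diff span_scale span_base)
  ultimately have "y + t *\<^sub>R w \<in> C" "y - t *\<^sub>R w \<in> C"
    using e F by blast+
  then have "(x - y) \<bullet> (y + t *\<^sub>R w - y) \<le> 0" "(x - y) \<bullet> (y - t *\<^sub>R w - y) \<le> 0"
    unfolding y_def using C
    by (intro closest_point_dot; auto simp: closed_convex_cone_def convex_cone_def)+
  then have "t * ((x - y) \<bullet> w) = 0"
    by simp
  then show ?thesis
    using t by (simp add: y_def)
qed

text \<open>The set of points projected into \<open>rel_interior F\<close> is an orthogonal sum of
  \<open>rel_interior F\<close> and a normal cone, so it is invariant under dilations of \<open>span F\<close>.\<close>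

lemma closest_point_scale_face:
  fixes C :: "'a::euclidean_space set"
  assumes C: "polyhedral_cone C" and F: "is_face_of_cone F C"
    and y: "closest_point C x \<in> rel_interior F" and "s > 0"
  shows "closest_point C (x + (s - 1) *\<^sub>R closest_point C x) = s *\<^sub>R closest_point C x"
    and "s *\<^sub>R closest_point C x \<in> rel_interior F"
proof -
  define y where "y = closest_point C x"
  have CC: "closed_convex_cone C" and FC: "convex_cone F" and sub: "F \<subseteq> C"
    using C F by (auto simp: polyhedral_cone_imp_closed_convex_cone is_face_of_cone_convex_cone
        is_face_of_cone_def)
  have yF: "y \<in> F"
    using y rel_interior_subset by (auto simp: y_def)
  \<comment> \<open>The dilated point minus \<open>s *\<^sub>R y\<close> is again
    \<open>x - y\<close>, so Moreau's conditions carry over.\<close>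
  have "(x - y) \<bullet> (s *\<^sub>R y) = 0"
    unfolding y_def using closest_point_cone[OF CC] by simp
  then show "closest_point C (x + (s - 1) *\<^sub>R closest_point C x) = s *\<^sub>R closest_point C x"
    using closest_point_cone(3)[OF CC, of x] sub yF \<open>s > 0\<close> FC
    by (intro closest_point_cone_eqI[OF CC])
      (auto simp: y_def algebra_simps convex_cone_scaleR)
  have "(*\<^sub>R) s ` F = F"
  proof (intro equalityI subsetI)
    fix z assume "z \<in> F"
    then have "inverse s *\<^sub>R z \<in> F"
      using FC \<open>s > 0\<close> by (simp add: convex_cone_scaleR)
    then show "z \<in> (*\<^sub>R) s ` F"
      using \<open>s > 0\<close> by (intro image_eqI[of _ _ "inverse s *\<^sub>R z"]) auto
  qed (use FC \<open>s > 0\<close> in \<open>auto simp: convex_cone_scaleR\<close>)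
  then show "s *\<^sub>R closest_point C x \<in> rel_interior F"
    using rel_interior_scaleR[of s F] \<open>s > 0\<close> y by auto
qed

section \<open>Gaussian exponential moments of polyhedral cones\<close>

lemma std_gaussian_density_eq:
  "std_gaussian_density (x::'a::euclidean_space) = (1 / sqrt (2 * pi)) ^ DIM('a) * exp (- (norm x)\<^sup>2 / 2)"
proof -
  have "(norm x)\<^sup>2 = (\<Sum>b\<in>Basis. (x \<bullet> b)\<^sup>2)"
    unfolding power2_norm_eq_inner by (subst euclidean_inner) (simp add: power2_eq_square)
  then have "exp (- (norm x)\<^sup>2 / 2) = (\<Prod>b\<in>Basis. exp (- (x \<bullet> b)\<^sup>2 / 2))"
    by (simp add: exp_sum[symmetric] sum_negf sum_divide_distrib)
  then show ?thesis
    by (simp add: std_gaussian_density_def std_normal_density_def prod_dividef power_divide)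
qed

lemma std_gaussian_density_nonneg [simp]: "0 \<le> std_gaussian_density x"
  by (simp add: std_gaussian_density_def prod_nonneg)

lemma borel_measurable_std_gaussian_density [measurable]:
  "std_gaussian_density \<in> borel_measurable borel"
  unfolding std_gaussian_density_def[abs_def] by measurable

lemma sets_std_gaussian [measurable_cong, simp]: "sets std_gaussian = sets borel"
  and space_std_gaussian [simp]: "space std_gaussian = UNIV"
  by (simp_all add: std_gaussian_def)

lemma nn_integral_std_gaussian:
  assumes [measurable]: "f \<in> borel_measurable borel"
  shows "(\<integral>\<^sup>+x. f x \<partial>std_gaussian) = (\<integral>\<^sup>+x. ennreal (std_gaussian_density x) * f x \<partial>lborel)"
  unfolding std_gaussian_def by (rule nn_integral_density) simp_all

lemma prob_space_std_gaussian: "prob_space (std_gaussian :: 'a::euclidean_space measure)"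
proof
  have "(\<integral>\<^sup>+x. ennreal (std_normal_density x) \<partial>lborel) = 1"
    using prob_space.emeasure_space_1[OF prob_space_normal_density[of 1 0]]
    by (simp add: emeasure_density)
  then have "(\<integral>\<^sup>+x. (\<Prod>b\<in>Basis. ennreal (std_normal_density ((x::'a) \<bullet> b))) \<partial>lborel) = 1"
    by (subst nn_integral_lborel_prod) simp_all
  then have "(\<integral>\<^sup>+x. ennreal (std_gaussian_density (x::'a)) \<partial>lborel) = 1"
    by (simp add: std_gaussian_density_def prod_ennreal)
  then show "emeasure (std_gaussian :: 'a measure) (space std_gaussian) = 1"
    unfolding std_gaussian_def by (simp add: emeasure_density)
qed

lemma borel_measurable_closest_point_cone:
  assumes "closed_convex_cone C"
  shows "closest_point C \<in> borel_measurable borel"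
  using assms
  by (intro borel_measurable_continuous_onI continuous_on_closest_point)
    (auto simp: closed_convex_cone_def convex_cone_def)

lemma borel_rel_interior:
  fixes S :: "'a::euclidean_space set"
  shows "rel_interior S \<in> sets borel"
proof -
  obtain T where "open T" "rel_interior S = affine hull S \<inter> T"
    using openin_rel_interior[of S] by (auto simp: openin_open)
  then show ?thesis
    using closed_affine_hull[of S] by auto
qed

text \<open>Nonnegative integrals avoid a prior integrability claim; finiteness for
  \<open>\<xi> > 0\<close> then comes out as a consequence.\<close>

lemma gaussian_exp_face:
  fixes C :: "'a::euclidean_space set"
  assumes C: "polyhedral_cone C" and F: "is_face_of_cone F C"
    and \<xi>: "\<xi> = (1 - exp (- 2 * \<eta>)) / 2"
  defines "A \<equiv> {x. closest_point C x \<in> rel_interior F}"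
  shows "(\<integral>\<^sup>+x. ennreal (exp (\<xi> * (norm (closest_point C x))\<^sup>2)) * indicator A x \<partial>std_gaussian) =
    ennreal (exp (\<eta> * real (dim F))) * emeasure std_gaussian A"
proof -
  have CC: "closed_convex_cone C"
    using C by (rule polyhedral_cone_imp_closed_convex_cone)
  note borel_measurable_closest_point_cone[OF CC, measurable] borel_rel_interior[measurable]
  have F0: "F \<subseteq> C" "0 \<in> F"
    using is_face_of_cone_convex_cone[OF C F] F
    by (auto simp: is_face_of_cone_def convex_cone_contains_0)
  obtain B where B: "pairwise orthogonal B" "\<And>b. b \<in> B \<Longrightarrow> norm b = 1"
      "independent B" "card B = dim (span F)" "span B = span F"
    using orthonormal_basis_subspace[OF subspace_span[of F]] by metis
  then have finB: "finite B"
    by (simp add: independent_imp_finite)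
  \<comment> \<open>The sum is the orthogonal projection of \<open>x\<close> onto
    \<open>span F\<close>, so \<open>T s\<close> multiplies that component by \<open>s\<close> and
    fixes the orthogonal one.\<close>
  define T where "T s x = x + (s - 1) *\<^sub>R (\<Sum>b\<in>B. (x \<bullet> b) *\<^sub>R b)" for s and x :: 'a
  have T_inverse: "T (inverse s) (T s x) = x" if "s > 0" for s x
  proof -
    have "(\<Sum>b\<in>B. (T s x \<bullet> b) *\<^sub>R b) = s *\<^sub>R (\<Sum>b\<in>B. (x \<bullet> b) *\<^sub>R b)"
      unfolding scaleR_sum_right
    proof (rule sum.cong)
      fix b assume b: "b \<in> B"
      have "(\<Sum>c\<in>B. (x \<bullet> c) *\<^sub>R c) \<bullet> b = (\<Sum>c\<in>B. if c = b then x \<bullet> b else 0)"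
        unfolding inner_sum_left using B(1,2) b
        by (intro sum.cong) (auto simp: pairwise_def orthogonal_def dot_square_norm)
      then have "T s x \<bullet> b = s * (x \<bullet> b)"
        using finB b by (simp add: T_def inner_add_left algebra_simps)
      then show "(T s x \<bullet> b) *\<^sub>R b = s *\<^sub>R (x \<bullet> b) *\<^sub>R b"
        by simp
    qed simp
    then show ?thesis
      using that by (simp add: T_def[of "inverse s"]) (simp add: T_def algebra_simps)
  qed
  \<comment> \<open>On \<open>A\<close> the residual of the metric projection is orthogonal to
    \<open>span F\<close>, so both projections of \<open>x\<close> coincide.\<close>
  have T_A: "T s x = x + (s - 1) *\<^sub>R closest_point C x" if "x \<in> A" for s x
  proof -
    have cp: "closest_point C x \<in> rel_interior F"
      using that by (simp add: A_def)
    then have "closest_point C x \<in> span F"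
      using rel_interior_subset span_superset by blast
    then have *: "(\<Sum>b\<in>B. (closest_point C x \<bullet> b) *\<^sub>R b) = closest_point C x"
      using B finB by (intro orthonormal_basis_expand) auto
    have "(x - closest_point C x) \<bullet> b = 0" if "b \<in> B" for b
      using closest_point_rel_interior_orthogonal[OF CC F0 cp] that B(5) span_superset by blast
    then have "(\<Sum>b\<in>B. (x \<bullet> b) *\<^sub>R b) = closest_point C x"
      by (subst *[symmetric]) (auto intro!: sum.cong simp: inner_diff_left)
    then show ?thesis
      by (simp add: T_def)
  qed
  have T_in: "T s x \<in> A" if "x \<in> A" "s > 0" for s x
    using closest_point_scale_face[OF C F, of x s] that T_A[OF that(1)] by (simp add: A_def)
  \<comment> \<open>With this choice \<open>s\<^sup>2 = 1 - 2 * \<xi>\<close>, which is what matches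
    the weight to the change of density.\<close>
  define s where "s = exp (- \<eta>)"
  have s: "s > 0"
    by (simp add: s_def)
  \<comment> \<open>The converse uses \<open>T_in\<close> for the inverse dilation.\<close>
  have iff: "T s x \<in> A \<longleftrightarrow> x \<in> A" for x
    using T_in[of x s] T_in[of "T s x" "inverse s"] s by (auto simp: T_inverse)
  have [measurable]: "A \<in> sets borel"
  proof -
    have "closest_point C -` rel_interior F \<inter> space borel \<in> sets borel"
      by measurable
    then show ?thesis
      by (simp add: A_def vimage_def)
  qed
  have dens: "std_gaussian_density x * exp (\<xi> * (norm (closest_point C x))\<^sup>2) =
      std_gaussian_density (T s x)" if "x \<in> A" for x
  proof -
    define y where "y = closest_point C x"
    have orth: "(x - y) \<bullet> y = 0"
      using closest_point_cone(2)[OF CC] by (simp add: y_def)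
    have "(norm ((x - y) + t *\<^sub>R y))\<^sup>2 = (norm (x - y))\<^sup>2 + t\<^sup>2 * (norm y)\<^sup>2" for t
      using orth by (subst norm_add_Pythagorean) (simp_all add: orthogonal_def power_mult_distrib)
    from this[of s] this[of 1]
    have "(norm (T s x))\<^sup>2 = (norm x)\<^sup>2 + (s\<^sup>2 - 1) * (norm y)\<^sup>2"
      by (simp add: T_A[OF that] y_def[symmetric] algebra_simps)
    moreover have "s\<^sup>2 = 1 - 2 * \<xi>"
      by (simp add: \<xi> s_def power2_eq_square exp_add[symmetric] diff_divide_distrib)
    ultimately have "(norm (T s x))\<^sup>2 = (norm x)\<^sup>2 - 2 * \<xi> * (norm y)\<^sup>2"
      by simp
    then have "exp (- (norm (T s x))\<^sup>2 / 2) = exp (- (norm x)\<^sup>2 / 2) * exp (\<xi> * (norm y)\<^sup>2)"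
      by (simp add: exp_add[symmetric] field_simps)
    then show ?thesis
      by (simp add: std_gaussian_density_eq y_def)
  qed
  define h where "h x = ennreal (std_gaussian_density x) * indicator A x" for x
  have [measurable]: "h \<in> borel_measurable borel"
    unfolding h_def by measurable
  have h: "(\<integral>\<^sup>+x. h x \<partial>lborel) = emeasure std_gaussian A"
    by (simp add: std_gaussian_def emeasure_density h_def)
  have "(\<integral>\<^sup>+x. ennreal (exp (\<xi> * (norm (closest_point C x))\<^sup>2)) * indicator A x \<partial>std_gaussian) =
      (\<integral>\<^sup>+x. h (T s x) \<partial>lborel)"
    by (subst nn_integral_std_gaussian)
      (auto intro!: nn_integral_cong simp: h_def iff dens[symmetric] ennreal_mult split: split_indicator)
  \<comment> \<open>The inserted factors multiply to 1; \<open>s ^ card B\<close> is the Jacobian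
    that the next change of variables absorbs.\<close>
  also have "\<dots> = ennreal (exp (\<eta> * real (dim F))) * (ennreal (s ^ card B) * (\<integral>\<^sup>+x. h (T s x) \<partial>lborel))"
    using B(4) by (simp add: mult.assoc[symmetric] ennreal_mult[symmetric] s_def
        exp_of_nat_mult[symmetric] exp_add[symmetric] mult.commute)
  also have "ennreal (s ^ card B) * (\<integral>\<^sup>+x. h (T s x) \<partial>lborel) = (\<integral>\<^sup>+x. h x \<partial>lborel)"
    unfolding T_def using B finB s by (intro nn_integral_lborel_scale_orthonormal) auto
  finally show ?thesis
    by (simp add: h)
qed

text \<open>The relative interiors of the faces partition \<open>C\<close>, so their preimages under
  the projection partition the space. The contributions of the faces are added and then grouped by
  dimension.\<close>

lemma polyhedral_cone_exp_moment:
  fixes C :: "'a::euclidean_space set"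
  assumes C: "polyhedral_cone C" and \<xi>: "\<xi> = (1 - exp (- 2 * \<eta>)) / 2"
  shows "integrable std_gaussian (\<lambda>x. exp (\<xi> * (norm (closest_point C x))\<^sup>2))"
    and "(\<integral>x. exp (\<xi> * (norm (closest_point C x))\<^sup>2) \<partial>std_gaussian) =
      (\<Sum>k\<le>DIM('a). exp (\<eta> * real k) * polyhedral_intrinsic_volume C k)"
proof -
  interpret prob_space "std_gaussian :: 'a measure"
    by (rule prob_space_std_gaussian)
  have CC: "closed_convex_cone C" and poly: "polyhedron C"
    using C by (simp_all add: polyhedral_cone_imp_closed_convex_cone polyhedral_cone_imp_polyhedron)
  note borel_measurable_closest_point_cone[OF CC, measurable] borel_rel_interior[measurable]
  define \<F> where "\<F> = {F. is_face_of_cone F C}"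
  define A where "A F = {x. closest_point C x \<in> rel_interior F}" for F
  have fin: "finite \<F>"
    by (rule finite_subset[OF _ finite_polyhedron_faces[OF poly]])
      (auto simp: \<F>_def is_face_of_cone_iff[OF C])
  have A_meas [measurable]: "A F \<in> sets borel" for F
  proof -
    have "closest_point C -` rel_interior F \<inter> space borel \<in> sets borel"
      by measurable
    then show ?thesis
      by (simp add: A_def vimage_def)
  qed
  have disj: "F = G" if "F \<in> \<F>" "G \<in> \<F>" "x \<in> A F" "x \<in> A G" for F G x
    using that face_of_eq[of F C G] by (auto simp: \<F>_def A_def is_face_of_cone_iff[OF C])
  have cover: "\<exists>F\<in>\<F>. x \<in> A F" for x
  proof -
    obtain F where "F face_of C" "closest_point C x \<in> rel_interior F"
      using face_with_point_in_rel_interior[OF poly closest_point_cone(1)[OF CC]] .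
    then show ?thesis
      using rel_interior_subset[of F]
      by (intro bexI[of _ F]) (auto simp: \<F>_def A_def is_face_of_cone_iff[OF C])
  qed
  have one: "(\<Sum>F\<in>\<F>. indicator (A F) x) = (1::ennreal)" for x
  proof -
    obtain G where G: "G \<in> \<F>" "x \<in> A G"
      using cover by blast
    then have "(\<Sum>F\<in>\<F>. indicator (A F) x) = (\<Sum>F\<in>\<F>. if F = G then 1 else (0::ennreal))"
      using disj by (intro sum.cong) (auto simp: indicator_def)
    then show ?thesis
      using fin G by simp
  qed
  have vol: "polyhedral_intrinsic_volume C k = (\<Sum>F | F \<in> \<F> \<and> dim F = k. measure std_gaussian (A F))" for k
  proof -
    have "{x. \<exists>F. is_face_of_cone F C \<and> dim F = k \<and> closest_point C x \<in> rel_interior F} =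
        (\<Union>F\<in>{F \<in> \<F>. dim F = k}. A F)"
      by (auto simp: \<F>_def A_def)
    then show ?thesis
      unfolding polyhedral_intrinsic_volume_def using fin disj
      by (simp, intro finite_measure_finite_Union) (auto simp: disjoint_family_on_def)
  qed
  have "(\<integral>\<^sup>+x. ennreal (exp (\<xi> * (norm (closest_point C x))\<^sup>2)) \<partial>std_gaussian) =
      (\<integral>\<^sup>+x. (\<Sum>F\<in>\<F>. ennreal (exp (\<xi> * (norm (closest_point C x))\<^sup>2)) * indicator (A F) x) \<partial>std_gaussian)"
    by (simp add: sum_distrib_left[symmetric] one)
  also have "\<dots> = (\<Sum>F\<in>\<F>. \<integral>\<^sup>+x. ennreal (exp (\<xi> * (norm (closest_point C x))\<^sup>2)) * indicator (A F) x \<partial>std_gaussian)"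
    by (rule nn_integral_sum) measurable
  also have "\<dots> = (\<Sum>F\<in>\<F>. ennreal (exp (\<eta> * real (dim F))) * emeasure std_gaussian (A F))"
    using gaussian_exp_face[OF C _ \<xi>] by (intro sum.cong) (auto simp: \<F>_def A_def)
  also have "\<dots> = ennreal (\<Sum>F\<in>\<F>. exp (\<eta> * real (dim F)) * measure std_gaussian (A F))"
    by (simp add: emeasure_eq_measure ennreal_mult[symmetric] sum_ennreal)
  also have "(\<Sum>F\<in>\<F>. exp (\<eta> * real (dim F)) * measure std_gaussian (A F)) =
      (\<Sum>k\<le>DIM('a). \<Sum>F | F \<in> \<F> \<and> dim F = k. exp (\<eta> * real (dim F)) * measure std_gaussian (A F))"
    using fin by (intro sum.group[symmetric]) (auto simp: dim_subset_UNIV)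
  also have "\<dots> = (\<Sum>k\<le>DIM('a). exp (\<eta> * real k) * polyhedral_intrinsic_volume C k)"
    by (auto intro!: sum.cong simp: vol sum_distrib_left)
  finally have nn: "(\<integral>\<^sup>+x. ennreal (exp (\<xi> * (norm (closest_point C x))\<^sup>2)) \<partial>std_gaussian) =
      ennreal (\<Sum>k\<le>DIM('a). exp (\<eta> * real k) * polyhedral_intrinsic_volume C k)" .
  show "integrable std_gaussian (\<lambda>x. exp (\<xi> * (norm (closest_point C x))\<^sup>2))"
    by (intro integrableI_nonneg) (auto simp: nn)
  show "(\<integral>x. exp (\<xi> * (norm (closest_point C x))\<^sup>2) \<partial>std_gaussian) =
      (\<Sum>k\<le>DIM('a). exp (\<eta> * real k) * polyhedral_intrinsic_volume C k)"
    by (rule integral_eq_nn_integral[THEN trans])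
      (auto simp: nn polyhedral_intrinsic_volume_def intro!: enn2real_ennreal sum_nonneg)
qed

section \<open>Convergence in the conic Hausdorff metric\<close>

text \<open>Ensures that the infimum in \<open>conic_hausdorff_dist\<close> of nonempty sets ranges
  over a nonempty set.\<close>

lemma conic_dist_le_pi: "conic_dist x y \<le> pi"
proof -
  have "\<bar>x \<bullet> y\<bar> \<le> norm x * norm y"
    by (rule Cauchy_Schwarz_ineq2)
  then have "\<bar>(x \<bullet> y) / (norm x * norm y)\<bar> \<le> 1" if "x \<noteq> 0" "y \<noteq> 0"
    using that by (simp add: abs_mult)
  then have "arccos ((x \<bullet> y) / (norm x * norm y)) \<le> pi" if "x \<noteq> 0" "y \<noteq> 0"
    using that by (intro arccos_ubound; simp only: abs_le_iff) linarith+
  then show ?thesis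
    by (simp add: conic_dist_def)
qed

lemma conic_dist_refl: "conic_dist x x = 0"
  by (simp add: conic_dist_def dot_square_norm power2_eq_square)

lemma conic_hausdorff_dist_less_imp:
  assumes "C1 \<noteq> {}" "C2 \<noteq> {}" "conic_hausdorff_dist C1 C2 < e"
  obtains \<alpha> where "0 \<le> \<alpha>" "\<alpha> < e" "C2 \<subseteq> conic_expansion C1 \<alpha>" "C1 \<subseteq> conic_expansion C2 \<alpha>"
proof -
  let ?S = "{\<alpha>. \<alpha> \<ge> 0 \<and> C2 \<subseteq> conic_expansion C1 \<alpha> \<and> C1 \<subseteq> conic_expansion C2 \<alpha>}"
  have "pi \<in> ?S"
    using assms(1,2) conic_dist_le_pi by (auto simp: conic_expansion_def)
  moreover have "bdd_below ?S"
    by (auto intro: bdd_belowI[of _ 0])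
  moreover have "Inf ?S < e"
    using assms(3) by (simp only: conic_hausdorff_dist_def)
  ultimately have "\<exists>\<alpha>\<in>?S. \<alpha> < e"
    using cInf_less_iff[of ?S e] by blast
  with that show thesis by auto
qed

text \<open>The projection \<open>y\<close> onto \<open>C\<close> has a point of \<open>D\<close> of
  the same norm at angle at most \<open>\<alpha>\<close>; the chord between them is no longer than
  the arc \<open>\<alpha> * norm y\<close>.\<close>

lemma dist_closest_point_conic_expansion:
  fixes C D :: "'a::euclidean_space set"
  assumes C: "closed_convex_cone C" and D: "closed_convex_cone D"
    and \<alpha>: "0 \<le> \<alpha>" "\<alpha> < pi / 2" and sub: "C \<subseteq> conic_expansion D \<alpha>"
  shows "dist x (closest_point D x) \<le> dist x (closest_point C x) + \<alpha> * norm x"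
proof -
  define y where "y = closest_point C x"
  have yC: "y \<in> C" and orth: "(x - y) \<bullet> y = 0"
    using closest_point_cone[OF C] by (simp_all add: y_def)
  have "orthogonal (x - y) y"
    using orth by (simp only: orthogonal_def)
  then have "(norm x)\<^sup>2 = (norm (x - y))\<^sup>2 + (norm y)\<^sup>2"
    using norm_add_Pythagorean by fastforce
  then have yx: "norm y \<le> norm x"
    using power2_le_imp_le[of "norm y" "norm x"] by simp
  have D': "closed D" "convex_cone D"
    using D by (simp_all add: closed_convex_cone_def)
  obtain z where z: "z \<in> D" "dist y z \<le> \<alpha> * norm y"
  proof (cases "y = 0")
    case True
    then show thesis
      using D' \<alpha> by (intro that[of 0]) (auto simp: convex_cone_contains_0)
  next
    case False
    obtain w where w: "w \<in> D" "conic_dist y w \<le> \<alpha>"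
      using sub yC by (auto simp: conic_expansion_def)
    \<comment> \<open>An angle below \<open>pi / 2\<close> excludes the value that
      \<open>conic_dist y 0\<close> takes by convention.\<close>
    with \<alpha> False have w0: "w \<noteq> 0"
      by (auto simp: conic_dist_def)
    define c where "c = (y \<bullet> w) / (norm y * norm w)"
    have "\<bar>y \<bullet> w\<bar> \<le> norm y * norm w"
      by (rule Cauchy_Schwarz_ineq2)
    then have c: "\<bar>c\<bar> \<le> 1"
      using False w0 by (simp add: c_def abs_mult)
    have "arccos c \<le> \<alpha>"
      using w False w0 by (simp add: conic_dist_def c_def)
    then have "cos \<alpha> \<le> cos (arccos c)"
      using c \<alpha> by (intro cos_monotone_0_pi_le arccos_lbound) (auto simp: abs_le_iff)
    then have cos: "cos \<alpha> \<le> c"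
      using c by (simp add: cos_arccos_abs)
    define z where "z = (norm y / norm w) *\<^sub>R w"
    have "y \<bullet> z = (norm y)\<^sup>2 * c"
      using False by (simp add: z_def c_def power2_eq_square)
    moreover have "norm z = norm y"
      using w0 by (simp add: z_def)
    ultimately have "(dist y z)\<^sup>2 = 2 * (1 - c) * (norm y)\<^sup>2"
      by (simp add: dist_norm power2_norm_eq_inner inner_diff inner_commute)
        (simp add: power2_norm_eq_inner[symmetric] algebra_simps)
    \<comment> \<open>By the half-angle formula,
      \<open>2 * (1 - cos \<alpha>) = 4 * (sin (\<alpha> / 2))\<^sup>2\<close>, and the sine is at
      most its argument.\<close>
    also have "\<dots> \<le> \<alpha>\<^sup>2 * (norm y)\<^sup>2"
    proof (intro mult_right_mono)
      have "cos \<alpha> = 1 - 2 * (sin (\<alpha> / 2))\<^sup>2"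
        using cos_double_sin[of "\<alpha> / 2"] by simp
      moreover have "(sin (\<alpha> / 2))\<^sup>2 \<le> (\<alpha> / 2)\<^sup>2"
        using \<alpha> by (intro power_mono sin_x_le_x sin_ge_zero) auto
      ultimately show "2 * (1 - c) \<le> \<alpha>\<^sup>2"
        using cos by (simp add: power_divide)
    qed simp
    finally have "(dist y z)\<^sup>2 \<le> (\<alpha> * norm y)\<^sup>2"
      by (simp add: power_mult_distrib)
    then have "dist y z \<le> \<alpha> * norm y"
      by (rule power2_le_imp_le) (use \<alpha> in simp)
    moreover have "z \<in> D"
      unfolding z_def using D' w by (intro convex_cone_scaleR) auto
    ultimately show thesis
      using that by blast
  qed
  have "dist x (closest_point D x) \<le> dist x z"
    using D' z by (intro closest_point_le)
  also have "\<dots> \<le> dist x y + dist y z"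
    by (rule dist_triangle)
  also have "\<dots> \<le> dist x y + \<alpha> * norm x"
    using z(2) mult_left_mono[OF yx \<alpha>(1)] by simp
  finally show ?thesis
    by (simp add: y_def)
qed

text \<open>By Pythagoras it suffices that the distances from \<open>x\<close> to the cones
  converge; the two inclusions in the Hausdorff metric bound their difference from both
  sides.\<close>

lemma norm_closest_point_tendsto:
  fixes C :: "'a::euclidean_space set"
  assumes C: "closed_convex_cone C" and Cs: "\<And>i. closed_convex_cone (Cs i)"
    and lim: "(\<lambda>i. conic_hausdorff_dist (Cs i) C) \<longlonglongrightarrow> 0"
  shows "(\<lambda>i. (norm (closest_point (Cs i) x))\<^sup>2) \<longlonglongrightarrow> (norm (closest_point C x))\<^sup>2"
proof -
  have ne: "D \<noteq> {}" if "closed_convex_cone D" for D :: "'a set"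
    using that by (simp add: closed_convex_cone_def convex_cone_nonempty)
  have Pyth: "(norm (closest_point D x))\<^sup>2 = (norm x)\<^sup>2 - (dist x (closest_point D x))\<^sup>2"
    if "closed_convex_cone D" for D
    using norm_add_Pythagorean[of "x - closest_point D x" "closest_point D x"]
      closest_point_cone(2)[OF that, of x]
    by (simp add: orthogonal_def dist_norm)
  have "(\<lambda>i. dist x (closest_point (Cs i) x)) \<longlonglongrightarrow> dist x (closest_point C x)"
  proof (rule tendstoI)
    fix e :: real assume "e > 0"
    \<comment> \<open>The first bound admits the distance estimate, the second keeps the error
      \<open>\<alpha> * norm x\<close> below \<open>e\<close>, also for
      \<open>x = 0\<close>.\<close>
    define d where "d = min (pi / 2) (e / (norm x + 1))"
    have d: "d > 0"
      using \<open>e > 0\<close> by (simp add: d_def add_nonneg_pos)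
    from order_tendstoD(2)[OF lim this]
    show "\<forall>\<^sub>F i in sequentially. dist (dist x (closest_point (Cs i) x)) (dist x (closest_point C x)) < e"
    proof eventually_elim
      case (elim i)
      obtain \<alpha> where \<alpha>: "0 \<le> \<alpha>" "\<alpha> < d"
        and sub: "C \<subseteq> conic_expansion (Cs i) \<alpha>" "Cs i \<subseteq> conic_expansion C \<alpha>"
        using conic_hausdorff_dist_less_imp[OF ne[OF Cs] ne[OF C] elim] .
      have "\<alpha> < pi / 2" "\<alpha> < e / (norm x + 1)"
        using \<alpha> by (simp_all add: d_def)
      have "\<alpha> * norm x \<le> \<alpha> * (norm x + 1)"
        using \<alpha> by (intro mult_left_mono) auto
      also have "\<dots> < e"
        using \<open>\<alpha> < e / (norm x + 1)\<close> by (simp add: pos_less_divide_eq add_nonneg_pos)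
      finally have "\<alpha> * norm x < e" .
      with dist_closest_point_conic_expansion[OF C Cs \<alpha>(1) \<open>\<alpha> < pi / 2\<close> sub(1), of x]
        dist_closest_point_conic_expansion[OF Cs C \<alpha>(1) \<open>\<alpha> < pi / 2\<close> sub(2), of x]
      show ?case
        by (simp add: dist_real_def)
    qed
  qed
  then show ?thesis
    unfolding Pyth[OF C] Pyth[OF Cs] by (intro tendsto_diff tendsto_power tendsto_const)
qed

section \<open>Density of the polyhedral cones\<close>

text \<open>A cone on which \<open>a \<bullet> x\<close> is bounded above by \<open>b\<close>
  satisfies \<open>a \<bullet> x \<le> 0\<close>, and \<open>b \<ge> 0\<close> because it contains
  the origin. Hence every offset may be replaced by 0.\<close>

lemma polyhedron_cone_imp_polyhedral_cone:
  fixes C :: "'a::euclidean_space set"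
  assumes "polyhedron C" "convex_cone C"
  shows "polyhedral_cone C"
proof -
  obtain H where H: "finite H" "C = \<Inter>H" and "\<forall>h\<in>H. \<exists>a b. a \<noteq> 0 \<and> h = {x. a \<bullet> x \<le> b}"
    using assms(1) by (auto simp: polyhedron_def)
  then obtain a b where ab: "\<And>h. h \<in> H \<Longrightarrow> h = {x. a h \<bullet> x \<le> b h}"
    by metis
  have "C = (\<Inter>u\<in>(\<lambda>h. - a h) ` H. {x. u \<bullet> x \<ge> 0})"
  proof (intro equalityI subsetI)
    fix x assume x: "x \<in> C"
    have "a h \<bullet> x \<le> 0" if "h \<in> H" for h
    proof (rule ccontr)
      assume "\<not> a h \<bullet> x \<le> 0"
      then have pos: "a h \<bullet> x > 0" by simp
      \<comment> \<open>Scaling by \<open>t\<close> pushes the inner product with \<open>a h\<close>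
        to \<open>\<bar>b h\<bar> + 1\<close>, beyond the bound \<open>b h\<close>.\<close>
      define t where "t = (\<bar>b h\<bar> + 1) / (a h \<bullet> x)"
      have "t *\<^sub>R x \<in> C"
        using assms(2) x pos by (intro convex_cone_scaleR) (auto simp: t_def)
      then have "a h \<bullet> (t *\<^sub>R x) \<le> b h"
        using H(2) ab that by blast
      then show False
        using pos by (simp add: t_def)
    qed
    then show "x \<in> (\<Inter>u\<in>(\<lambda>h. - a h) ` H. {x. u \<bullet> x \<ge> 0})"
      by simp
  next
    fix x assume x: "x \<in> (\<Inter>u\<in>(\<lambda>h. - a h) ` H. {x. u \<bullet> x \<ge> 0})"
    have "x \<in> h" if "h \<in> H" for h
    proof -
      have "0 \<in> h"
        using convex_cone_contains_0[OF assms(2)] H that by blast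
      then have "0 \<le> b h"
        using ab[OF that] by (metis inner_zero_right mem_Collect_eq)
      moreover have "a h \<bullet> x \<le> 0"
        using x that by auto
      ultimately show ?thesis
        using ab[OF that] by (metis (mono_tags) mem_Collect_eq order_trans)
    qed
    then show "x \<in> C"
      using H by blast
  qed
  with H(1) show ?thesis
    unfolding polyhedral_cone_def by blast
qed

text \<open>For unit vectors the squared chord is \<open>2 - 2 * (u \<bullet> p)\<close>, so a bound
  on the chord bounds the cosine; \<open>d \<le> 1\<close> keeps the argument of
  \<open>arccos\<close> in its domain.\<close>

lemma conic_dist_le_arccos:
  assumes "norm p = 1" "x \<noteq> 0" "dist (x /\<^sub>R norm x) p \<le> d" "d \<le> 1"
  shows "conic_dist x p \<le> arccos (1 - d\<^sup>2 / 2)"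
proof -
  define u where "u = x /\<^sub>R norm x"
  have u: "norm u = 1"
    using assms by (simp add: u_def)
  have p0: "p \<noteq> 0"
    using assms(1) by auto
  have d: "0 \<le> d"
    using assms(3) zero_le_dist order_trans by blast
  have "(dist u p)\<^sup>2 = 2 - 2 * (u \<bullet> p)"
    using u assms(1)
    by (simp add: dist_norm power2_norm_eq_inner inner_diff inner_commute)
      (simp add: power2_norm_eq_inner[symmetric] dot_square_norm)
  moreover have "(dist u p)\<^sup>2 \<le> d\<^sup>2"
    using assms(3) by (intro power_mono) (auto simp: u_def)
  ultimately have "1 - d\<^sup>2 / 2 \<le> u \<bullet> p"
    by simp
  moreover have "d\<^sup>2 \<le> 1"
    using d assms(4) by (simp add: power_le_one)
  moreover have "u \<bullet> p \<le> 1"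
    using Cauchy_Schwarz_ineq2[of u p] u assms(1) by simp
  ultimately have "arccos (u \<bullet> p) \<le> arccos (1 - d\<^sup>2 / 2)"
    by (intro arccos_le_arccos) auto
  moreover have "(x \<bullet> p) / (norm x * norm p) = u \<bullet> p"
    using assms(1) by (simp add: u_def field_simps)
  ultimately show ?thesis
    using assms(2) p0 by (simp add: conic_dist_def)
qed

text \<open>\<open>D\<close> is generated by a finite \<open>d\<close>-net of the unit vectors in
  \<open>C\<close>. It lies inside \<open>C\<close>, so only covering \<open>C\<close> by an
  expansion of \<open>D\<close> costs an angle.\<close>

lemma polyhedral_cone_approximation:
  fixes C :: "'a::euclidean_space set"
  assumes C: "closed_convex_cone C" and d: "0 < d" "d \<le> 1"
  obtains D where "polyhedral_cone D" "\<bar>conic_hausdorff_dist D C\<bar> \<le> arccos (1 - d\<^sup>2 / 2)"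
proof -
  have cone: "convex_cone C" and cl: "closed C"
    using C by (simp_all add: closed_convex_cone_def)
  define K where "K = C \<inter> sphere 0 1"
  have "compact K"
    unfolding K_def by (intro closed_Int_compact cl compact_sphere)
  then obtain P where P: "finite P" "P \<subseteq> K" "K \<subseteq> (\<Union>p\<in>P. ball p d)"
    using compactE_image[of K K "\<lambda>p. ball p d"] d
    by (metis UN_I centre_in_ball open_ball subsetI)
  define D where "D = convex_cone hull P"
  have D: "polyhedral_cone D"
    unfolding D_def using P
    by (intro polyhedron_cone_imp_polyhedral_cone polyhedron_convex_cone_hull convex_cone_convex_cone_hull)
  have DC: "D \<subseteq> C"
    unfolding D_def using P cone by (intro hull_minimal) (auto simp: K_def)
  define \<alpha> where "\<alpha> = arccos (1 - d\<^sup>2 / 2)"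
  have "d\<^sup>2 \<le> 1"
    using d by (simp add: power_le_one)
  then have \<alpha>: "0 \<le> \<alpha>"
    unfolding \<alpha>_def by (intro arccos_lbound) auto
  have "x \<in> conic_expansion D \<alpha>" if x: "x \<in> C" for x
  proof (cases "x = 0")
    case True
    then show ?thesis
      using \<alpha> by (auto simp: conic_expansion_def D_def conic_dist_refl convex_cone_hull_contains_0
          intro!: bexI[of _ 0])
  next
    case False
    have "x /\<^sub>R norm x \<in> K"
      using False x cone by (simp add: K_def convex_cone_scaleR)
    then obtain p where p: "p \<in> P" "dist (x /\<^sub>R norm x) p < d"
      using P(3) by (auto simp: dist_commute)
    then have "conic_dist x p \<le> \<alpha>"
      unfolding \<alpha>_def using P(2) False d
      by (intro conic_dist_le_arccos) (auto simp: K_def)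
    then show ?thesis
      using p by (auto simp: conic_expansion_def D_def intro: hull_inc)
  qed
  moreover have "D \<subseteq> conic_expansion C \<alpha>"
    using DC \<alpha> by (auto simp: conic_expansion_def intro!: bexI simp: conic_dist_refl)
  ultimately have mem: "\<alpha> \<in> {\<alpha>. \<alpha> \<ge> 0 \<and> C \<subseteq> conic_expansion D \<alpha> \<and> D \<subseteq> conic_expansion C \<alpha>}" (is "_ \<in> ?S")
    using \<alpha> by blast
  then have "Inf ?S \<le> \<alpha>"
    by (intro cInf_lower) (auto intro: bdd_belowI[of _ 0])
  moreover have "0 \<le> Inf ?S"
    using mem by (intro cInf_greatest) auto
  ultimately have "\<bar>conic_hausdorff_dist D C\<bar> \<le> \<alpha>"
    by (simp add: conic_hausdorff_dist_def)
  with D that show thesis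
    by (simp add: \<alpha>_def)
qed

lemma polyhedral_cones_dense:
  fixes C :: "'a::euclidean_space set"
  assumes "closed_convex_cone C"
  obtains Cs :: "nat \<Rightarrow> 'a set" where "\<And>i. polyhedral_cone (Cs i)"
    "(\<lambda>i. conic_hausdorff_dist (Cs i) C) \<longlonglongrightarrow> 0"
proof -
  define d where "d i = inverse (real (Suc i))" for i
  have "\<exists>D. polyhedral_cone D \<and> \<bar>conic_hausdorff_dist D C\<bar> \<le> arccos (1 - (d i)\<^sup>2 / 2)" for i
  proof -
    have "0 < d i" "d i \<le> 1"
      by (simp_all add: d_def inverse_le_1_iff)
    then show ?thesis
      using polyhedral_cone_approximation[OF assms] by metis
  qed
  then obtain Cs where Cs: "\<And>i. polyhedral_cone (Cs i)"
      "\<And>i. \<bar>conic_hausdorff_dist (Cs i) C\<bar> \<le> arccos (1 - (d i)\<^sup>2 / 2)"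
    by metis
  have d: "d \<longlonglongrightarrow> 0"
    unfolding d_def by (rule LIMSEQ_inverse_real_of_nat)
  \<comment> \<open>The limit 1 is an endpoint of the domain of \<open>arccos\<close>, so continuity
    is used on \<open>{- 1..1}\<close> and the sequence has to stay there.\<close>
  have "(\<lambda>i. arccos (1 - (d i)\<^sup>2 / 2)) \<longlonglongrightarrow> arccos (1 - 0\<^sup>2 / 2)"
  proof (rule continuous_on_tendsto_compose[OF continuous_on_arccos'])
    show "(\<lambda>i. 1 - (d i)\<^sup>2 / 2) \<longlonglongrightarrow> 1 - 0\<^sup>2 / 2"
      by (intro tendsto_intros d) simp
    have "(d i)\<^sup>2 \<le> 1" for i
      by (simp add: d_def power_le_one inverse_le_1_iff)
    then have "1 - (d i)\<^sup>2 / 2 \<in> {- 1..1}" for i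
      using order_trans[of "(d i)\<^sup>2" 1 4] by simp
    then show "\<forall>\<^sub>F i in sequentially. 1 - (d i)\<^sup>2 / 2 \<in> {- 1..1}"
      by simp
  qed simp
  then have "(\<lambda>i. arccos (1 - (d i)\<^sup>2 / 2)) \<longlonglongrightarrow> 0"
    by simp
  then have "(\<lambda>i. conic_hausdorff_dist (Cs i) C) \<longlonglongrightarrow> 0"
    by (rule Lim_null_comparison[rotated]) (use Cs in simp)
  with Cs that show thesis by blast
qed

section \<open>Exponential moments of closed convex cones\<close>

text \<open>The combination \<open>p (2 t) - 2 ^ (n + 1) p(t)\<close> lowers the degree and scales the remaining
  coefficients by nonzero constants.\<close>

lemma convergent_coeffs_of_convergent_polynomials:
  fixes a :: "nat \<Rightarrow> nat \<Rightarrow> real"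
  assumes "\<And>t. t > 0 \<Longrightarrow> convergent (\<lambda>i. \<Sum>k\<le>n. a i k * t ^ k)" and "k \<le> n"
  shows "convergent (\<lambda>i. a i k)"
  using assms
proof (induction n arbitrary: a k)
  case 0
  then show ?case
    using "0.prems"(1)[of 1] by simp
next
  case (Suc n)
  define c where "c k = (2::real) ^ k - 2 ^ Suc n" for k
  have c: "c k \<noteq> 0" if "k \<le> n" for k
    using that power_strict_increasing[of k "Suc n" "2::real"] by (simp add: c_def)
  have low: "convergent (\<lambda>i. a i k)" if "k \<le> n" for k
  proof -
    have "convergent (\<lambda>i. a i k * c k)"
    proof (rule Suc.IH[of "\<lambda>i k. a i k * c k", OF _ that])
      fix t :: real assume "t > 0"
      have "(\<Sum>k\<le>n. a i k * c k * t ^ k) =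
          (\<Sum>k\<le>Suc n. a i k * (2 * t) ^ k) - 2 ^ Suc n * (\<Sum>k\<le>Suc n. a i k * t ^ k)" for i
        by (simp add: c_def sum_distrib_left sum_subtractf[symmetric] power_mult_distrib algebra_simps)
      then show "convergent (\<lambda>i. \<Sum>k\<le>n. a i k * c k * t ^ k)"
        using Suc.prems(1)[of "2 * t"] Suc.prems(1)[of t] \<open>t > 0\<close>
        by (simp only:) (intro convergent_diff convergent_mult convergent_const; simp)
    qed
    then have "convergent (\<lambda>i. a i k * c k * inverse (c k))"
      by (rule convergent_mult) (rule convergent_const)
    moreover have "a i k * c k * inverse (c k) = a i k" for i
      using c[OF that] by simp
    ultimately show ?thesis
      by (simp only:)
  qed
  show ?case
  proof (cases "k = Suc n")
    case True
    \<comment> \<open>At \<open>t = 1\<close> the polynomial is the sum of its coefficients, so the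
      top one is recovered by subtraction.\<close>
    have "convergent (\<lambda>i. (\<Sum>k\<le>Suc n. a i k * 1 ^ k) - (\<Sum>k\<le>n. a i k))"
      by (rule convergent_diff[OF Suc.prems(1) convergent_sum]) (auto intro: low)
    then show ?thesis
      by (simp add: True)
  next
    case False
    with low Suc.prems(2) show ?thesis by simp
  qed
qed

text \<open>A nonzero polynomial has finitely many roots, but the difference would vanish on all
  positive reals.\<close>

lemma coeffs_eq_of_eq_on_pos:
  fixes a b :: "nat \<Rightarrow> real"
  assumes "\<And>t. t > 0 \<Longrightarrow> (\<Sum>k\<le>n. a k * t ^ k) = (\<Sum>k\<le>n. b k * t ^ k)" and "k \<le> n"
  shows "a k = b k"
proof (rule ccontr)
  assume "a k \<noteq> b k"
  then have "finite {t. (\<Sum>k\<le>n. (a k - b k) * t ^ k) = 0}"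
    using assms(2) by (intro polyfun_roots_finite[of _ k]) auto
  moreover have "{0<..} \<subseteq> {t. (\<Sum>k\<le>n. (a k - b k) * t ^ k) = 0}"
    using assms(1) by (auto simp: left_diff_distrib sum_subtractf)
  ultimately show False
    using infinite_Ioi[of "0::real"] finite_subset by blast
qed

text \<open>The coefficients converge to some limits; passing to the limit termwise and comparing
  coefficients identifies these.\<close>

lemma coeffs_tendsto_of_polynomials_tendsto:
  fixes a :: "nat \<Rightarrow> nat \<Rightarrow> real"
  assumes "\<And>t. t > 0 \<Longrightarrow> (\<lambda>i. \<Sum>k\<le>n. a i k * t ^ k) \<longlonglongrightarrow> (\<Sum>k\<le>n. b k * t ^ k)" and "k \<le> n"
  shows "(\<lambda>i. a i k) \<longlonglongrightarrow> b k"
proof -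
  have conv: "(\<lambda>i. a i k) \<longlonglongrightarrow> lim (\<lambda>i. a i k)" if "k \<le> n" for k
    using convergent_coeffs_of_convergent_polynomials[where n = n and a = a and k = k] assms(1) that
    by (auto simp: convergent_LIMSEQ_iff[symmetric] intro: convergentI)
  have "lim (\<lambda>i. a i k) = b k"
  proof (rule coeffs_eq_of_eq_on_pos[where n = n])
    fix t :: real assume "t > 0"
    have "(\<lambda>i. \<Sum>k\<le>n. a i k * t ^ k) \<longlonglongrightarrow> (\<Sum>k\<le>n. lim (\<lambda>i. a i k) * t ^ k)"
      by (intro tendsto_sum tendsto_mult_right conv) auto
    with assms(1)[OF \<open>t > 0\<close>]
    show "(\<Sum>k\<le>n. lim (\<lambda>i. a i k) * t ^ k) = (\<Sum>k\<le>n. b k * t ^ k)"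
      using LIMSEQ_unique by blast
  qed fact
  with conv[OF assms(2)] show ?thesis by simp
qed

section \<open>Passage from polyhedral to general cones\<close>

text \<open>The limit is taken on the Gaussian side, where the weights converge pointwise, and the
  polyhedral formula transfers it to the sums.\<close>

lemma exp_moment_tendsto:
  fixes C :: "'a::euclidean_space set"
  assumes C: "closed_convex_cone C" and Cs: "\<And>i. polyhedral_cone (Cs i)"
    and lim: "(\<lambda>i. conic_hausdorff_dist (Cs i) C) \<longlonglongrightarrow> 0"
    and \<xi>: "\<xi> = (1 - exp (- 2 * \<eta>)) / 2"
  shows "(\<lambda>i. \<Sum>k\<le>DIM('a). exp (\<eta> * real k) * polyhedral_intrinsic_volume (Cs i) k)
    \<longlonglongrightarrow> (\<integral>x. exp (\<xi> * (norm (closest_point C x))\<^sup>2) \<partial>std_gaussian)"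
proof -
  interpret prob_space "std_gaussian :: 'a measure"
    by (rule prob_space_std_gaussian)
  have CCs: "closed_convex_cone (Cs i)" for i
    using Cs by (rule polyhedral_cone_imp_closed_convex_cone)
  note [measurable] = borel_measurable_closest_point_cone[OF C] borel_measurable_closest_point_cone[OF CCs]
  \<comment> \<open>Projection onto the whole space is the identity, so the polyhedral case itself
    supplies the integrability of the dominating function.\<close>
  have "polyhedral_cone (UNIV :: 'a set)"
    by (auto simp: polyhedral_cone_def intro!: exI[of _ "{}"])
  from polyhedral_cone_exp_moment(1)[OF this \<xi>]
  have int: "integrable std_gaussian (\<lambda>x::'a. exp (\<xi> * (norm x)\<^sup>2))"
    by (simp add: closest_point_self)
  \<comment> \<open>The two summands serve the two signs of \<open>\<xi>\<close>: the weight is at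
    most 1 if \<open>\<xi> \<le> 0\<close>, and otherwise projecting does not increase the
    norm.\<close>
  have bound: "exp (\<xi> * (norm (closest_point (Cs i) x))\<^sup>2) \<le> 1 + exp (\<xi> * (norm x)\<^sup>2)" for i x
  proof (cases "\<xi> \<le> 0")
    case True
    then have "exp (\<xi> * (norm (closest_point (Cs i) x))\<^sup>2) \<le> 1"
      by (simp add: mult_nonpos_nonneg)
    then show ?thesis
      using exp_ge_zero[of "\<xi> * (norm x)\<^sup>2"] by linarith
  next
    case False
    have "orthogonal (x - closest_point (Cs i) x) (closest_point (Cs i) x)"
      using closest_point_cone(2)[OF CCs] by (simp only: orthogonal_def)
    then have "(norm (closest_point (Cs i) x))\<^sup>2 \<le> (norm x)\<^sup>2"
      using norm_add_Pythagorean[of "x - closest_point (Cs i) x" "closest_point (Cs i) x"] by simp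
    with False have "exp (\<xi> * (norm (closest_point (Cs i) x))\<^sup>2) \<le> exp (\<xi> * (norm x)\<^sup>2)"
      by simp
    then show ?thesis by linarith
  qed
  have "(\<lambda>i. \<integral>x. exp (\<xi> * (norm (closest_point (Cs i) x))\<^sup>2) \<partial>std_gaussian)
    \<longlonglongrightarrow> (\<integral>x. exp (\<xi> * (norm (closest_point C x))\<^sup>2) \<partial>std_gaussian)"
  proof (rule integral_dominated_convergence[where w = "\<lambda>x. 1 + exp (\<xi> * (norm x)\<^sup>2)"])
    show "integrable std_gaussian (\<lambda>x::'a. 1 + exp (\<xi> * (norm x)\<^sup>2))"
      using int by simp
    show "AE x in std_gaussian. (\<lambda>i. exp (\<xi> * (norm (closest_point (Cs i) x))\<^sup>2))
        \<longlonglongrightarrow> exp (\<xi> * (norm (closest_point C x))\<^sup>2)"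
      by (intro AE_I2 tendsto_exp tendsto_mult_left norm_closest_point_tendsto[OF C CCs lim])
    show "AE x in std_gaussian. norm (exp (\<xi> * (norm (closest_point (Cs i) x))\<^sup>2))
        \<le> 1 + exp (\<xi> * (norm x)\<^sup>2)" for i
      using bound by simp
  qed measurable
  then show ?thesis
    by (simp add: polyhedral_cone_exp_moment(2)[OF Cs \<xi>])
qed

text \<open>Since the exponential moments are polynomials in \<open>exp \<eta>\<close>, their convergence forces that
  of the intrinsic volumes, so that the \<open>THE\<close> in the definition is well-defined.\<close>

lemma closed_convex_cone_exp_moment:
  fixes C :: "'a::euclidean_space set"
  assumes C: "closed_convex_cone C" and \<xi>: "\<xi> = (1 - exp (- 2 * \<eta>)) / 2"
  shows "(\<integral>x. exp (\<xi> * (norm (closest_point C x))\<^sup>2) \<partial>std_gaussian) =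
      (\<Sum>k\<le>DIM('a). exp (\<eta> * real k) * conic_intrinsic_volume C k)"
proof (cases "polyhedral_cone C")
  case True
  then show ?thesis
    by (simp add: polyhedral_cone_exp_moment(2)[OF _ \<xi>] conic_intrinsic_volume_def)
next
  case False
  \<comment> \<open>With \<open>t = exp \<eta>\<close> the moments of polyhedral cones become
    polynomials in \<open>t\<close>.\<close>
  define G where "G t = (\<integral>x. exp ((1 - exp (- 2 * ln t)) / 2 * (norm (closest_point C x))\<^sup>2) \<partial>std_gaussian)"
    for t
  have G: "(\<lambda>i. \<Sum>k\<le>DIM('a). polyhedral_intrinsic_volume (Cs i) k * t ^ k) \<longlonglongrightarrow> G t"
    if "\<And>i. polyhedral_cone (Cs i)" "(\<lambda>i. conic_hausdorff_dist (Cs i) C) \<longlonglongrightarrow> 0" "t > 0" for Cs t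
  proof -
    have "exp (ln t * real k) = t ^ k" for k
      using that(3) by (simp add: mult.commute exp_of_nat_mult)
    then show ?thesis
      using exp_moment_tendsto[OF C that(1,2) refl, of "ln t"] by (simp add: G_def mult.commute)
  qed
  \<comment> \<open>One approximating sequence provides the candidate value \<open>v\<close> and
    forces its uniqueness.\<close>
  obtain Ds where Ds: "\<And>i. polyhedral_cone (Ds i)" "(\<lambda>i. conic_hausdorff_dist (Ds i) C) \<longlonglongrightarrow> 0"
    using polyhedral_cones_dense[OF C] by metis
  define v where "v k = lim (\<lambda>i. polyhedral_intrinsic_volume (Ds i) k)" for k
  have v: "(\<lambda>i. polyhedral_intrinsic_volume (Ds i) k) \<longlonglongrightarrow> v k" if "k \<le> DIM('a)" for k
    unfolding v_def convergent_LIMSEQ_iff[symmetric]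
    by (rule convergent_coeffs_of_convergent_polynomials[where n = "DIM('a)"])
      (use G[OF Ds] that in \<open>auto intro: convergentI\<close>)
  have Gv: "G t = (\<Sum>k\<le>DIM('a). v k * t ^ k)" if "t > 0" for t
    by (rule LIMSEQ_unique[OF G[OF Ds that]]) (intro tendsto_sum tendsto_mult_right v, simp)
  have "conic_intrinsic_volume C k = v k" if k: "k \<le> DIM('a)" for k
  proof -
    have *: "(\<lambda>i. polyhedral_intrinsic_volume (Cs i) k) \<longlonglongrightarrow> v k"
      if "\<And>i. polyhedral_cone (Cs i)" "(\<lambda>i. conic_hausdorff_dist (Cs i) C) \<longlonglongrightarrow> 0" for Cs
      by (rule coeffs_tendsto_of_polynomials_tendsto[OF _ k]) (use G[OF that] in \<open>simp add: Gv\<close>)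
    have "(THE w. \<forall>Cs. (\<forall>i. polyhedral_cone (Cs i)) \<and> (\<lambda>i. conic_hausdorff_dist (Cs i) C) \<longlonglongrightarrow> 0 \<longrightarrow>
        (\<lambda>i. polyhedral_intrinsic_volume (Cs i) k) \<longlonglongrightarrow> w) = v k"
    proof (rule the_equality)
      fix w assume "\<forall>Cs. (\<forall>i. polyhedral_cone (Cs i)) \<and> (\<lambda>i. conic_hausdorff_dist (Cs i) C) \<longlonglongrightarrow> 0 \<longrightarrow>
        (\<lambda>i. polyhedral_intrinsic_volume (Cs i) k) \<longlonglongrightarrow> w"
      then have "(\<lambda>i. polyhedral_intrinsic_volume (Ds i) k) \<longlonglongrightarrow> w"
        using Ds by simp
      then show "w = v k"
        by (rule LIMSEQ_unique) (rule v[OF k])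
    qed (simp add: *)
    with False show ?thesis
      by (simp add: conic_intrinsic_volume_def)
  qed
  then have "(\<Sum>k\<le>DIM('a). exp (\<eta> * real k) * conic_intrinsic_volume C k) =
      (\<Sum>k\<le>DIM('a). v k * exp \<eta> ^ k)"
    by (intro sum.cong) (simp_all add: exp_of_nat2_mult[symmetric])
  also have "\<dots> = (\<integral>x. exp (\<xi> * (norm (closest_point C x))\<^sup>2) \<partial>std_gaussian)"
    using Gv[of "exp \<eta>"] by (simp add: G_def \<xi>)
  finally show ?thesis by simp
qed

text \<open>At \<open>\<eta> = \<xi> = 0\<close> the moment identity says that the Gaussian has
  total mass 1.\<close>

lemma sum_conic_intrinsic_volume:
  fixes C :: "'a::euclidean_space set"
  assumes "closed_convex_cone C"
  shows "(\<Sum>k\<le>DIM('a). conic_intrinsic_volume C k) = 1"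
  using closed_convex_cone_exp_moment[OF assms, of 0 0] prob_space.prob_space[OF prob_space_std_gaussian[where 'a = 'a]]
  by simp

theorem proposition4p6:
  fixes C :: "(real ^ 'd) set"
    and M :: "'m measure" and g :: "'m \<Rightarrow> real ^ 'd"
    and N :: "'n measure" and V :: "'n \<Rightarrow> nat"
    and \<eta> \<xi> :: real
  assumes "closed_convex_cone C"
    and "prob_space M"
    and "distributed M lborel g (\<lambda>x. ennreal (std_gaussian_density x))"
    and "prob_space N"
    and "V \<in> measurable N (count_space UNIV)"
    and "\<forall>k\<in>{0..CARD('d)}. measure N {\<omega> \<in> space N. V \<omega> = k} = conic_intrinsic_volume C k"
    and "\<xi> = (1 - exp (- 2 * \<eta>)) / 2"
  shows "prob_space.expectation N (\<lambda>\<omega>. exp (\<eta> * real (V \<omega>)))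
       = prob_space.expectation M (\<lambda>\<omega>. exp (\<xi> * (norm (closest_point C (g \<omega>)))\<^sup>2))"
proof -
  interpret N: prob_space N by fact
  note [measurable] = assms(5) borel_measurable_closest_point_cone[OF assms(1)]
  have g [measurable]: "g \<in> measurable M borel"
    using distributed_measurable[OF assms(3)] by simp
  define E where "E k = {\<omega> \<in> space N. V \<omega> = k}" for k
  have [measurable]: "E k \<in> sets N" for k
    unfolding E_def by measurable
  have vol: "measure N (E k) = conic_intrinsic_volume C k" if "k \<le> CARD('d)" for k
    using assms(6) that by (simp add: E_def)
  \<comment> \<open>The prescribed probabilities already sum to 1, so \<open>V\<close> exceeds
    \<open>CARD('d)\<close> only on a null set and its moment is a finite sum.\<close>
  have "measure N (\<Union>k\<le>CARD('d). E k) = (\<Sum>k\<le>CARD('d). measure N (E k))"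
    by (intro N.finite_measure_finite_Union) (auto simp: disjoint_family_on_def E_def)
  also have "\<dots> = 1"
    using sum_conic_intrinsic_volume[OF assms(1)] by (simp add: vol)
  finally have "AE \<omega> in N. \<omega> \<in> (\<Union>k\<le>CARD('d). E k)"
    by (subst N.AE_in_set_eq_1) auto
  then have "AE \<omega> in N. exp (\<eta> * real (V \<omega>)) = (\<Sum>k\<le>CARD('d). exp (\<eta> * real k) * indicator (E k) \<omega>)"
  proof eventually_elim
    case (elim \<omega>)
    then have "V \<omega> \<le> CARD('d)" "\<omega> \<in> space N"
      by (auto simp: E_def)
    then have "(\<Sum>k\<le>CARD('d). exp (\<eta> * real k) * indicator (E k) \<omega>) =
        (\<Sum>k\<le>CARD('d). if k = V \<omega> then exp (\<eta> * real (V \<omega>)) else 0)"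
      by (intro sum.cong) (auto simp: E_def indicator_def)
    with \<open>V \<omega> \<le> CARD('d)\<close> show ?case by simp
  qed
  then have "N.expectation (\<lambda>\<omega>. exp (\<eta> * real (V \<omega>))) =
      N.expectation (\<lambda>\<omega>. \<Sum>k\<le>CARD('d). exp (\<eta> * real k) * indicator (E k) \<omega>)"
    by (intro integral_cong_AE) measurable
  also have "\<dots> = (\<Sum>k\<le>CARD('d). exp (\<eta> * real k) * conic_intrinsic_volume C k)"
    by (subst Bochner_Integration.integral_sum) (auto intro!: sum.cong simp: vol N.emeasure_eq_measure)
  also have "\<dots> = (\<integral>x. exp (\<xi> * (norm (closest_point C x))\<^sup>2) \<partial>std_gaussian)"
    using closed_convex_cone_exp_moment[OF assms(1,7)] by simp
  also have "std_gaussian = distr M lborel g"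
    using distributed_distr_eq_density[OF assms(3)] by (simp add: std_gaussian_def)
  also have "(\<integral>x. exp (\<xi> * (norm (closest_point C x))\<^sup>2) \<partial>distr M lborel g) =
      (\<integral>\<omega>. exp (\<xi> * (norm (closest_point C (g \<omega>)))\<^sup>2) \<partial>M)"
    by (intro integral_distr) measurable
  finally show ?thesis .
qed

end
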